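(* Let $\mathbf{S}_1, \dots, \mathbf{S}_n$ be independent random complex matrices with common dimension $d_1 \times d_2$, and assume that $$\mathbb{E}\, \mathbf{S}_k = \mathbf{0} \quad\text{and}\quad \|\mathbf{S}_k\| \leq L \quad\text{for each } k = 1, \dots, n.$$ Introduce the sum $\mathbf{Z} = \sum_{k=1}^n \mathbf{S}_k$, and let $$v(\mathbf{Z}) = \max\big\{ \|\mathbb{E}(\mathbf{Z}\mathbf{Z}^* )\|,\ \|\mathbb{E}(\mathbf{Z}^*\mathbf{Z})\| \big\} = \max\left\{ \left\| \sum_{k=1}^n \mathbb{E}(\mathbf{S}_k\mathbf{S}_k^* ) \right\|,\ \left\| \sum_{k=1}^n \mathbb{E}(\mathbf{S}_k^*\mathbf{S}_k) \right\| \right\}.$$ Then $$\mathbb{P}\{ \|\mathbf{Z}\| \geq t \} \leq (d_1 + d_2) \cdot \exp\left( \frac{-t^2/2}{v(\mathbf{Z}) + Lt/3} \right) \quad\text{for all } t \geq 0.$$ Furthermore, $$\mathbb{E}\, \|\mathbf{Z}\| \leq \sqrt{2\, v(\mathbf{Z}) \log(d_1 + d_2)} + \frac{1}{3} L \log(d_1 + d_2).$$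
   Context: $\|\cdot\|$ is the spectral norm of a matrix (its largest singular value), ${}^*$ is the conjugate transpose, $\log$ is the natural logarithm, and the expectation of a random matrix is taken entrywise. *)

theory Defs
  imports "HOL-Probability.Probability"
begin

text \<open>A complex \<open>d1 \<times> d2\<close> matrix is an element of \<^typ>\<open>complex^'d2^'d1\<close>
  (\<open>'d1\<close> indexes the rows), with \<open>d1 = CARD('d1)\<close> and \<open>d2 = CARD('d2)\<close>.\<close>

definition conj_transpose :: "complex^'n^'m \<Rightarrow> complex^'m^'n" where
  "conj_transpose A = (\<chi> i j. cnj (A $ j $ i))"

definition eigenvalue :: "complex^'n^'n \<Rightarrow> complex \<Rightarrow> bool" where
  "eigenvalue A c \<longleftrightarrow> (\<exists>x. x \<noteq> 0 \<and> A *v x = c *s x)"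

text \<open>The singular values of \<open>A\<close> are the square roots of the eigenvalues of the positive
  semidefinite matrix \<open>A\<^sup>* A\<close>. When \<open>d2 > d1\<close> this set may contain an additional \<open>0\<close>
  compared with conventions that count only \<open>min d1 d2\<close> singular values; the largest
  element is not affected. The set is finite and nonempty, so \<open>Max\<close> is its largest element.\<close>

definition singular_values :: "complex^'n^'m \<Rightarrow> real set" where
  "singular_values A =
     {s. s \<ge> 0 \<and> eigenvalue (conj_transpose A ** A) (complex_of_real (s\<^sup>2))}"

definition spectral_norm :: "complex^'n^'m \<Rightarrow> real" where
  "spectral_norm A = Max (singular_values A)"

definition matrix_expectation :: "'a measure \<Rightarrow> ('a \<Rightarrow> complex^'n^'m) \<Rightarrow> complex^'n^'m" where
  "matrix_expectation M X = (\<chi> i j. integral\<^sup>L M (\<lambda>\<omega>. X \<omega> $ i $ j))"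

definition matrix_variance :: "'a measure \<Rightarrow> ('a \<Rightarrow> complex^'n^'m) \<Rightarrow> real" where
  "matrix_variance M Z =
     max (spectral_norm (matrix_expectation M (\<lambda>\<omega>. Z \<omega> ** conj_transpose (Z \<omega>))))
         (spectral_norm (matrix_expectation M (\<lambda>\<omega>. conj_transpose (Z \<omega>) ** Z \<omega>)))"

end

theory Submission
  imports Defs
begin

text \<open>
  The proof is the matrix Laplace transform method. With a parameter \<open>\<theta>\<close>, the probability
  and the mean of \<open>\<parallel>Z\<parallel>\<close> are controlled by \<open>E exp (\<theta> \<parallel>Z\<parallel>)\<close>, which is at most the expected trace of
  the exponential of a self-adjoint random matrix. The sharp constants need the matrix cumulant
  generating function to be subadditive over independent summands. Splitting the exponential of a
  sum by the Golden-Thompson inequality is too lossy for that; the right tool is the Jensen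
  inequality that underlies Lieb's concavity theorem: if \<open>E exp X \<le> exp K\<close> in the semidefinite order,
  then \<open>E tr exp (H + X) \<le> tr exp (H + K)\<close> for every fixed \<open>H\<close> (\<open>trace_mexp_jensen\<close>).

  This inequality is reduced to the joint convexity of the relative entropy
  \<open>D(A, B) = tr A (log A - log B)\<close>. By the identity \<open>a (log (N a + b) - log b) = \<integral>\<^sub>0\<^sup>N a\<^sup>2 / (t a + b) dt\<close>,
  the relative entropy is, up to \<open>log N tr A\<close> and an error \<open>tr B / N\<close>, an integral of quantities
  each of which is a supremum over a matrix \<open>W\<close> of functions linear in \<open>(A, B)\<close>. Fixing for every
  \<open>t\<close> the optimal \<open>W\<close> for one pair \<open>(A\<^sub>0, B\<^sub>0)\<close> and integrating gives, up to these two corrections, a linear functional below \<open>D\<close>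
  that touches it at that pair (\<open>relative_entropy_tangent\<close>). A linear functional commutes with the
  expectation, so no measurability question about eigenvectors arises. The tangent functional
  at \<open>A\<^sub>0 = E exp (H + X)\<close>, \<open>B\<^sub>0 = exp K\<close> together with the Gibbs variational inequality
  (\<open>mexp_gibbs_inequality\<close>) yields the claim as \<open>N\<close> tends to infinity.

  Applying it to one summand at a time, with the other summands frozen by Fubini
  (\<open>trace_mexp_sum_le\<close>), replaces each random \<open>\<theta> X\<^sub>k\<close> by the deterministic matrix
  \<open>g(\<theta>) E X\<^sub>k\<^sup>2\<close> with \<open>g(\<theta>) = \<theta>\<^sup>2 / (2 (1 - \<theta> L / 3))\<close>, because \<open>exp y \<le> 1 + y + y\<^sup>2 / (2 (1 - c / 3))\<close>
  whenever \<open>\<bar>y\<bar> \<le> c < 3\<close>.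

  A rectangular complex matrix \<open>A\<close> enters through the self-adjoint map
  \<open>(x, y) \<mapsto> (A y, A\<^sup>* x)\<close>, whose square is block diagonal with blocks \<open>A A\<^sup>*\<close> and \<open>A\<^sup>* A\<close>. Only the real
  inner product structure is used: the map becomes a real symmetric matrix of size
  \<open>2 (d\<^sub>1 + d\<^sub>2)\<close>. The spurious factor 2 disappears, since every real eigenspace of the map is
  closed under multiplication by \<open>\<i>\<close> and the top eigenvalue \<open>\<parallel>A\<parallel>\<close> is therefore at least double
  (\<open>trace_mexp_dilation_ge\<close>). What remains is the scalar optimization over \<open>\<theta>\<close>.
\<close>

section \<open>The spectral theorem\<close>

definition orthonormal :: "('i \<Rightarrow> 'a::real_inner) \<Rightarrow> bool" where
  "orthonormal u \<longleftrightarrow> (\<forall>i j. u i \<bullet> u j = (if i = j then 1 else 0))"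

lemma orthonormalD: "orthonormal u \<Longrightarrow> u i \<bullet> u j = (if i = j then 1 else 0)"
  by (simp add: orthonormal_def)

lemma orthonormal_norm: "orthonormal u \<Longrightarrow> norm (u i) = 1"
  by (simp add: orthonormal_def norm_eq_sqrt_inner)

lemma orthonormal_expand:
  fixes u :: "'i::finite \<Rightarrow> 'a::euclidean_space"
  assumes u: "orthonormal u" and card: "CARD('i) = DIM('a)"
  shows "x = (\<Sum>i\<in>UNIV. (x \<bullet> u i) *\<^sub>R u i)"
proof -
  have inj: "inj u"
  proof (rule injI)
    fix i j assume "u i = u j"
    then have "u i \<bullet> u j = 1" using orthonormalD[OF u, of i i] by simp
    then show "i = j" using orthonormalD[OF u, of i j] by (simp split: if_splits)
  qed
  have po: "pairwise orthogonal (range u)"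
    using u by (auto simp: pairwise_def orthonormal_def orthogonal_def)
  have "0 \<notin> range u"
    using orthonormal_norm[OF u] by (metis norm_zero rangeE zero_neq_one)
  then have ind: "independent (range u)"
    using po by (rule pairwise_orthogonal_independent[rotated])
  have "span (range u) = UNIV"
    using ind card card_image[OF inj] card_eq_dim[of "range u" UNIV] by auto
  then have "x \<in> span (range u)" by simp
  then obtain c where c: "x = (\<Sum>v\<in>range u. c v *\<^sub>R v)"
    by (auto simp: span_finite)
  then have c': "x = (\<Sum>i\<in>UNIV. c (u i) *\<^sub>R u i)"
    by (simp add: sum.reindex[OF inj])
  have "x \<bullet> u j = c (u j)" for j
    by (subst c') (simp add: inner_sum_left orthonormalD[OF u] if_distrib[where f="\<lambda>x. _ * x"] cong: if_cong)
  then show ?thesis using c' by simp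
qed

lemma orthonormal_inner:
  fixes u :: "'i::finite \<Rightarrow> 'a::euclidean_space"
  assumes u: "orthonormal u" and card: "CARD('i) = DIM('a)"
  shows "x \<bullet> y = (\<Sum>i\<in>UNIV. (u i \<bullet> x) * (u i \<bullet> y))"
  by (subst orthonormal_expand[OF assms, of x]) (simp add: inner_sum_left inner_commute[of x])

text \<open>A maximizer of the Rayleigh quotient over the unit sphere of an invariant subspace is an
  eigenvector: moving it in the direction of the residual \<open>y = f x - (x \<bullet> f x) x\<close> would otherwise
  increase the quotient to first order.\<close>

lemma selfadjoint_max_eigenvector:
  fixes f :: "'a::euclidean_space \<Rightarrow> 'a"
  assumes f: "linear f" and sa: "\<And>x y. f x \<bullet> y = x \<bullet> f y"
    and S: "subspace S" and inv: "\<And>x. x \<in> S \<Longrightarrow> f x \<in> S" and "S \<noteq> {0}"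
  obtains x where "x \<in> S" "norm x = 1" "f x = (x \<bullet> f x) *\<^sub>R x"
proof -
  let ?K = "S \<inter> sphere 0 1"
  have cont: "continuous_on ?K (\<lambda>x. x \<bullet> f x)"
    by (intro continuous_intros linear_continuous_on linear_conv_bounded_linear[THEN iffD1] f)
  have comp: "compact ?K"
    using closed_subspace[OF S] by (intro closed_Int_compact) auto
  obtain y where y: "y \<in> S" "y \<noteq> 0"
    using \<open>S \<noteq> {0}\<close> subspace_0[OF S] by blast
  then have "y /\<^sub>R norm y \<in> ?K"
    using S by (auto simp: subspace_scale)
  then have "?K \<noteq> {}" by blast
  then obtain x where x: "x \<in> ?K" and mx: "\<And>z. z \<in> ?K \<Longrightarrow> z \<bullet> f z \<le> x \<bullet> f x"
    using continuous_attains_sup[OF comp _ cont] by blast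
  define m where "m = x \<bullet> f x"
  have xx: "x \<bullet> x = 1" using x by (simp add: norm_eq_1)
  have bound: "z \<bullet> f z \<le> m * (z \<bullet> z)" if "z \<in> S" for z
  proof (cases "z = 0")
    case True then show ?thesis by (simp add: linear_0[OF f])
  next
    case False
    have "z /\<^sub>R norm z \<in> ?K" using that False S by (auto simp: subspace_scale)
    from mx[OF this] have "(z \<bullet> f z) / (norm z)^2 \<le> m"
      by (simp add: linear_cmul[OF f] m_def power2_eq_square field_simps)
    then show ?thesis using False by (simp add: divide_le_eq dot_square_norm)
  qed
  define y where "y = f x - m *\<^sub>R x"
  have yS: "y \<in> S" using x S inv by (auto simp: y_def subspace_diff subspace_scale)
  have xy: "x \<bullet> y = 0" by (simp add: y_def inner_diff_right m_def xx)
  have yfx: "y \<bullet> f x = y \<bullet> y"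
    using xy by (simp add: y_def inner_diff_right inner_diff_left inner_commute algebra_simps)
  \<comment> \<open>Maximality at \<open>x + e y\<close>: the first-order term in \<open>e\<close> must vanish.\<close>
  have key: "2 * e * (y \<bullet> y) \<le> e\<^sup>2 * (m * (y \<bullet> y) - y \<bullet> f y)" for e :: real
  proof -
    have "x + e *\<^sub>R y \<in> S" using x yS S by (auto simp: subspace_add subspace_scale)
    from bound[OF this] show ?thesis
      using xy yfx sa[of x y]
      by (simp add: linear_add[OF f] linear_cmul[OF f] inner_add_left inner_add_right
        m_def[symmetric] xx inner_commute algebra_simps power2_eq_square)
  qed
  define c where "c = y \<bullet> y"
  define k where "k = \<bar>m * (y \<bullet> y) - y \<bullet> f y\<bar> + 1"
  have kpos: "k > 0" by (simp add: k_def)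
  have "c \<le> 0"
  proof (rule ccontr)
    assume "\<not> c \<le> 0"
    then have cp: "c > 0" by simp
    have "2 * (c / k) * c \<le> (c/k)\<^sup>2 * (m * (y \<bullet> y) - y \<bullet> f y)"
      using key[of "c / k"] by (simp add: c_def)
    also have "\<dots> \<le> (c/k)\<^sup>2 * k" by (intro mult_left_mono) (auto simp: k_def)
    also have "\<dots> = (c / k) * c" using kpos by (simp add: power2_eq_square)
    finally have "2 * ((c / k) * c) \<le> (c / k) * c" by simp
    moreover have "(c / k) * c > 0" using cp kpos by simp
    ultimately show False by linarith
  qed
  then have "y = 0" using inner_ge_zero[of y] by (simp add: c_def antisym)
  then have "f x = m *\<^sub>R x" by (simp add: y_def)
  then show ?thesis using that[of x] x by (simp add: m_def)
qed

text \<open>Split off one eigenvector and pass to its orthogonal complement, which is again invariant.\<close>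

lemma selfadjoint_eigenbasis_subspace:
  fixes f :: "'a::euclidean_space \<Rightarrow> 'a"
  assumes f: "linear f" and sa: "\<And>x y. f x \<bullet> y = x \<bullet> f y"
    and "subspace S" "\<And>x. x \<in> S \<Longrightarrow> f x \<in> S"
  shows "\<exists>B. B \<subseteq> S \<and> pairwise orthogonal B \<and> (\<forall>b\<in>B. norm b = 1 \<and> f b = (b \<bullet> f b) *\<^sub>R b) \<and> span B = S"
  using assms(3,4)
proof (induction "dim S" arbitrary: S rule: less_induct)
  case (less S)
  show ?case
  proof (cases "S = {0}")
    case True
    then show ?thesis by (intro exI[of _ "{}"]) auto
  next
    case False
    obtain x where x: "x \<in> S" "norm x = 1" "f x = (x \<bullet> f x) *\<^sub>R x"
      using selfadjoint_max_eigenvector[OF f sa less.prems False] by blast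
    have xx: "x \<bullet> x = 1" using x by (simp add: norm_eq_1)
    define S' where "S' = S \<inter> {y. x \<bullet> y = 0}"
    have S': "subspace S'"
      unfolding S'_def by (intro subspace_inter less.prems subspace_hyperplane)
    have inv': "f y \<in> S'" if "y \<in> S'" for y
    proof -
      have "x \<bullet> f y = f x \<bullet> y" by (simp add: sa)
      also have "\<dots> = (x \<bullet> f x) * (x \<bullet> y)" by (subst x(3)) simp
      finally show ?thesis using that less.prems by (simp add: S'_def)
    qed
    have "x \<notin> S'" by (simp add: S'_def xx)
    then have "S' \<subset> S" using x(1) unfolding S'_def by blast
    then have "dim S' < dim S"
      by (metis S' dim_psubset less.prems(1) span_eq_iff)
    then obtain B where B: "B \<subseteq> S'" "pairwise orthogonal B"
      "\<forall>b\<in>B. norm b = 1 \<and> f b = (b \<bullet> f b) *\<^sub>R b" "span B = S'"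
      using less.hyps[OF _ S' inv'] by blast
    have 1: "pairwise orthogonal (insert x B)"
      using B by (auto simp: pairwise_insert S'_def orthogonal_def inner_commute)
    have 2: "insert x B \<subseteq> S" using x B by (auto simp: S'_def)
    have "y \<in> span (insert x B)" if "y \<in> S" for y
    proof -
      have "y - (x \<bullet> y) *\<^sub>R x \<in> S'"
        using that x less.prems by (auto simp: S'_def inner_diff_right xx subspace_diff subspace_scale)
      then have "y - (x \<bullet> y) *\<^sub>R x \<in> span B" using B by simp
      then show ?thesis by (auto simp: span_insert)
    qed
    moreover have "span (insert x B) \<subseteq> S" using 2 less.prems by (simp add: span_minimal)
    ultimately have "span (insert x B) = S" by blast
    then show ?thesis using 1 2 x B by (intro exI[of _ "insert x B"]) simp
  qed
qed

text \<open>The index type is free up to its cardinality, so that the same theorem serves real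
  matrices (indexed by their coordinates) and complex vector spaces viewed as real ones.\<close>

theorem selfadjoint_spectral_theorem:
  fixes f :: "'a::euclidean_space \<Rightarrow> 'a"
  assumes f: "linear f" and sa: "\<And>x y. f x \<bullet> y = x \<bullet> f y" and card: "CARD('i::finite) = DIM('a)"
  obtains u :: "'i::finite \<Rightarrow> 'a" and a where "orthonormal u" "\<And>i. f (u i) = a i *\<^sub>R u i"
proof -
  obtain B where B: "pairwise orthogonal B" "\<forall>b\<in>B. norm b = 1 \<and> f b = (b \<bullet> f b) *\<^sub>R b" "span B = UNIV"
    using selfadjoint_eigenbasis_subspace[OF f sa, of UNIV] by auto
  have "0 \<notin> B" using B(2) by force
  then have ind: "independent B" using B(1) by (simp add: pairwise_orthogonal_independent)
  then have "card B = DIM('a)" using B(3) by (metis basis_card_eq_dim dim_UNIV subset_UNIV order_refl)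
  then obtain u :: "'i \<Rightarrow> 'a" where u: "bij_betw u UNIV B"
    using card independent_imp_finite[OF ind] by (metis finite_same_card_bij finite_class.finite_UNIV)
  have "u i \<bullet> u j = (if i = j then 1 else 0)" for i j
  proof (cases "i = j")
    case True
    then show ?thesis using B(2) u by (auto simp: bij_betw_def norm_eq_1)
  next
    case False
    then have "u i \<noteq> u j" "u i \<in> B" "u j \<in> B" using u by (auto simp: bij_betw_def inj_on_def)
    then show ?thesis using B(1) False by (auto simp: pairwise_def orthogonal_def)
  qed
  then have "orthonormal u" by (simp add: orthonormal_def)
  moreover have "f (u i) = (u i \<bullet> f (u i)) *\<^sub>R u i" for i
    using B(2) u by (auto simp: bij_betw_def)
  ultimately show ?thesis by (rule that)
qed

section \<open>Eigensystems and the exponential of a symmetric matrix\<close>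

definition outer :: "real^'m \<Rightarrow> real^'n \<Rightarrow> real^'n^'m" where
  "outer u v = (\<chi> i j. u $ i * v $ j)"

lemma outer_mult_vec: "outer u v *v x = (v \<bullet> x) *\<^sub>R u"
  by (simp add: outer_def matrix_vector_mult_def vec_eq_iff inner_vec_def sum_distrib_left mult_ac)

lemma sum_matrix_vector_mult:
  fixes A :: "'i \<Rightarrow> real^'n^'m"
  shows "(\<Sum>i\<in>I. A i) *v x = (\<Sum>i\<in>I. A i *v x)"
  by (induction I rule: infinite_finite_induct) (auto simp: matrix_vector_mult_add_rdistrib)

text \<open>Parseval for the Frobenius inner product, the inner product that matrices carry as vectors of
  vectors. Using different bases on the two sides matters: it expresses quantities of two
  non-commuting matrices through the eigenbases of both.\<close>

lemma inner_matrix_orthonormal: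
  fixes P Q :: "real^'n^'m" and u :: "'m \<Rightarrow> real^'m" and v :: "'n \<Rightarrow> real^'n"
  assumes u: "orthonormal u" and v: "orthonormal v"
  shows "P \<bullet> Q = (\<Sum>i\<in>UNIV. \<Sum>j\<in>UNIV. (u i \<bullet> (P *v v j)) * (u i \<bullet> (Q *v v j)))"
proof -
  have "P \<bullet> Q = (\<Sum>k\<in>UNIV. \<Sum>j\<in>UNIV. (v j \<bullet> P $ k) * (v j \<bullet> Q $ k))"
    unfolding inner_vec_def[of P] by (intro sum.cong refl orthonormal_inner v) simp
  also have "\<dots> = (\<Sum>j\<in>UNIV. (P *v v j) \<bullet> (Q *v v j))"
    by (subst sum.swap) (simp add: inner_vec_def[of "_ *v _"] matrix_vector_mul_component inner_commute)
  also have "\<dots> = (\<Sum>j\<in>UNIV. \<Sum>i\<in>UNIV. (u i \<bullet> (P *v v j)) * (u i \<bullet> (Q *v v j)))"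
    by (intro sum.cong refl orthonormal_inner u) simp
  finally show ?thesis by (subst sum.swap)
qed

text \<open>A quadratic form is a Frobenius inner product, hence linear in the matrix; this is how
  expectations and integrals are moved through quadratic forms.\<close>

lemma inner_matrix_vector: "x \<bullet> (A *v y) = (A :: real^'n^'m) \<bullet> outer x y"
  by (simp add: inner_vec_def matrix_vector_mult_def outer_def sum_distrib_left sum_distrib_right mult_ac)

lemma symmetric_inner:
  fixes A :: "real^'n^'n"
  assumes "transpose A = A"
  shows "(A *v x) \<bullet> y = x \<bullet> (A *v y)"
  by (metis assms dot_lmul_matrix transpose_matrix_vector)

lemma matrix_eq_on_orthonormal:
  fixes A B :: "real^'n^'m" and u :: "'n \<Rightarrow> real^'n"
  assumes u: "orthonormal u" and eq: "\<And>i. A *v u i = B *v u i"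
  shows "A = B"
proof -
  have "A *v x = B *v x" for x
    by (subst (1 2) orthonormal_expand[OF u, of x])
      (simp_all add: linear_sum[OF matrix_vector_mul_linear] linear_cmul[OF matrix_vector_mul_linear] eq)
  then show ?thesis by (simp add: matrix_eq)
qed

definition eigensystem :: "real^'n^'n \<Rightarrow> ('n \<Rightarrow> real^'n) \<Rightarrow> ('n \<Rightarrow> real) \<Rightarrow> bool" where
  "eigensystem A u a \<longleftrightarrow> orthonormal u \<and> (\<forall>i. A *v u i = a i *\<^sub>R u i)"

lemma eigensystem_orthonormal: "eigensystem A u a \<Longrightarrow> orthonormal u"
  and eigensystem_eq: "eigensystem A u a \<Longrightarrow> A *v u i = a i *\<^sub>R u i"
  by (auto simp: eigensystem_def)

lemma symmetric_eigensystem: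
  fixes A :: "real^'n^'n"
  assumes "transpose A = A"
  obtains u a where "eigensystem A u a"
proof -
  obtain u :: "'n \<Rightarrow> real^'n" and a where "orthonormal u" "\<And>i. A *v u i = a i *\<^sub>R u i"
    using selfadjoint_spectral_theorem[OF matrix_vector_mul_linear symmetric_inner[OF assms]]
    by (metis DIM_cart DIM_real mult.right_neutral)
  then show ?thesis using that by (auto simp: eigensystem_def)
qed

lemma eigensystem_unique: "eigensystem A u a \<Longrightarrow> eigensystem B u a \<Longrightarrow> A = B"
  by (rule matrix_eq_on_orthonormal[of u]) (auto simp: eigensystem_def)

lemma eigensystem_sum_outer:
  "orthonormal u \<Longrightarrow> eigensystem (\<Sum>i\<in>UNIV. a i *\<^sub>R outer (u i) (u i)) u a"
  by (simp add: eigensystem_def sum_matrix_vector_mult scaleR_matrix_vector_assoc[symmetric]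
      outer_mult_vec orthonormalD if_distrib[where f="\<lambda>x. x *\<^sub>R _"] if_distrib[where f="\<lambda>x. _ *\<^sub>R x"] cong: if_cong)

lemma eigensystem_expand:
  "eigensystem A u a \<Longrightarrow> A = (\<Sum>i\<in>UNIV. a i *\<^sub>R outer (u i) (u i))"
  using eigensystem_unique eigensystem_sum_outer eigensystem_orthonormal by blast

lemma transpose_outer: "transpose (outer u v) = outer v u"
  by (simp add: transpose_def outer_def vec_eq_iff)

lemma linear_transpose: "linear (transpose :: real^'n^'m \<Rightarrow> real^'m^'n)"
  by (rule linearI) (simp_all add: transpose_def vec_eq_iff)

lemma eigensystem_symmetric: "eigensystem A u a \<Longrightarrow> transpose A = A"
  by (subst (1 2) eigensystem_expand, assumption, assumption)
    (simp add: linear_sum[OF linear_transpose] linear_cmul[OF linear_transpose] transpose_outer)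

lemma eigensystem_mat_1: "orthonormal u \<Longrightarrow> eigensystem (mat 1) u (\<lambda>_. 1)"
  by (simp add: eigensystem_def)

text \<open>The weights \<open>(u i \<bullet> v j)\<^sup>2\<close> form a doubly stochastic array. It reduces trace inequalities for two
  non-commuting matrices to inequalities between pairs of eigenvalues.\<close>

lemma eigensystem_inner:
  assumes "eigensystem A u a" "eigensystem B v b"
  shows "A \<bullet> B = (\<Sum>i\<in>UNIV. \<Sum>j\<in>UNIV. (u i \<bullet> v j)\<^sup>2 * (a i * b j))"
proof -
  have "u i \<bullet> (A *v v j) = a i * (u i \<bullet> v j)" for i j
    using symmetric_inner[OF eigensystem_symmetric[OF assms(1)], of "u i" "v j"]
    by (simp add: eigensystem_eq[OF assms(1)])
  moreover have "u i \<bullet> (B *v v j) = b j * (u i \<bullet> v j)" for i j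
    by (simp add: eigensystem_eq[OF assms(2)])
  ultimately show ?thesis
    by (simp add: inner_matrix_orthonormal[OF eigensystem_orthonormal[OF assms(1)] eigensystem_orthonormal[OF assms(2)]]
        power2_eq_square mult_ac)
qed

lemma trace_inner_mat_1: "trace (A :: real^'n^'n) = A \<bullet> mat 1"
  by (simp add: trace_def inner_vec_def mat_def if_distrib[where f="\<lambda>x. _ * x"] cong: if_cong)

lemma orthonormal_sum_squares:
  fixes v :: "'n \<Rightarrow> real^'n"
  assumes "orthonormal v"
  shows "(\<Sum>j\<in>UNIV. (x \<bullet> v j)\<^sup>2) = x \<bullet> x"
  using orthonormal_inner[OF assms, of x x] by (simp add: power2_eq_square inner_commute)

lemma eigensystem_trace_left:
  fixes A :: "real^'n^'n"
  assumes "eigensystem A u a" and v: "orthonormal (v :: 'n \<Rightarrow> real^'n)"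
  shows "trace A = (\<Sum>i\<in>UNIV. \<Sum>j\<in>UNIV. (u i \<bullet> v j)\<^sup>2 * a i)"
  unfolding trace_inner_mat_1 eigensystem_inner[OF assms(1) eigensystem_mat_1[OF v]] by simp

lemma eigensystem_trace_right:
  fixes B :: "real^'n^'n"
  assumes "eigensystem B v b" and u: "orthonormal (u :: 'n \<Rightarrow> real^'n)"
  shows "trace B = (\<Sum>i\<in>UNIV. \<Sum>j\<in>UNIV. (u i \<bullet> v j)\<^sup>2 * b j)"
  unfolding trace_inner_mat_1 inner_commute[of B] eigensystem_inner[OF eigensystem_mat_1[OF u] assms(1)] by simp

lemma eigensystem_trace: "eigensystem A u a \<Longrightarrow> trace A = (\<Sum>i\<in>UNIV. a i)"
  by (subst eigensystem_trace_left[of A u a u])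
    (auto simp: eigensystem_orthonormal orthonormalD[OF eigensystem_orthonormal] if_distrib[where f="\<lambda>x. x * _"]
      if_distrib[where f="\<lambda>x. x ^ _"] cong: if_cong)

lemma eigensystem_quadratic:
  assumes "eigensystem A u a"
  shows "x \<bullet> (A *v x) = (\<Sum>i\<in>UNIV. a i * (x \<bullet> u i)\<^sup>2)"
  by (subst eigensystem_expand[OF assms])
    (simp add: sum_matrix_vector_mult scaleR_matrix_vector_assoc[symmetric] outer_mult_vec
      inner_sum_right power2_eq_square inner_commute mult_ac)

text \<open>The exponential is introduced by its power series because this form depends measurably on the
  matrix; the description in an eigenbasis, which involves a choice, is then a lemma.\<close>

primrec mpow :: "real^'n^'n \<Rightarrow> nat \<Rightarrow> real^'n^'n" where
  "mpow A 0 = mat 1"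
| "mpow A (Suc k) = A ** mpow A k"

definition mexp :: "real^'n^'n \<Rightarrow> real^'n^'n" where
  "mexp A = (\<Sum>k. mpow A k /\<^sub>R fact k)"

lemma eigensystem_mpow: "eigensystem A u a \<Longrightarrow> eigensystem (mpow A k) u (\<lambda>i. a i ^ k)"
  by (induction k)
    (auto simp: eigensystem_def matrix_vector_mul_assoc[symmetric] matrix_vector_mult_scaleR)

lemma eigensystem_mexp:
  assumes "eigensystem A u a"
  shows "eigensystem (mexp A) u (\<lambda>i. exp (a i))"
proof -
  have "(\<lambda>k. \<Sum>i\<in>UNIV. (a i ^ k /\<^sub>R fact k) *\<^sub>R outer (u i) (u i)) sums
      (\<Sum>i\<in>UNIV. exp (a i) *\<^sub>R outer (u i) (u i))"
    by (intro sums_sum sums_scaleR_left exp_converges)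
  moreover have "mpow A k /\<^sub>R fact k = (\<Sum>i\<in>UNIV. (a i ^ k /\<^sub>R fact k) *\<^sub>R outer (u i) (u i))" for k
    by (subst eigensystem_expand[OF eigensystem_mpow[OF assms]]) (simp add: scaleR_sum_right mult_ac)
  ultimately have "mexp A = (\<Sum>i\<in>UNIV. exp (a i) *\<^sub>R outer (u i) (u i))"
    unfolding mexp_def by (simp add: sums_iff)
  then show ?thesis
    using eigensystem_sum_outer eigensystem_orthonormal[OF assms] by metis
qed

lemma positive_definite_is_mexp:
  fixes A :: "real^'n^'n"
  assumes "transpose A = A" "\<And>x. x \<noteq> 0 \<Longrightarrow> x \<bullet> (A *v x) > 0"
  obtains Y where "transpose Y = Y" "mexp Y = A"
proof -
  obtain u a where ua: "eigensystem A u a" using symmetric_eigensystem[OF assms(1)] .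
  have on: "orthonormal u" by (rule eigensystem_orthonormal[OF ua])
  have "a i > 0" for i
    using assms(2)[of "u i"] orthonormalD[OF on, of i i] orthonormal_norm[OF on, of i]
    by (force simp: eigensystem_eq[OF ua])
  then have e: "(\<lambda>i. exp (ln (a i))) = a" by auto
  define Y where "Y = (\<Sum>i\<in>UNIV. ln (a i) *\<^sub>R outer (u i) (u i))"
  have Y: "eigensystem Y u (\<lambda>i. ln (a i))"
    unfolding Y_def by (rule eigensystem_sum_outer[OF on])
  have "mexp Y = A"
    using eigensystem_unique[OF eigensystem_mexp[OF Y]] ua e by simp
  then show ?thesis using that eigensystem_symmetric[OF Y] by blast
qed

text \<open>The sum over \<open>i\<close> alone is spread over an arbitrary second basis so that it can be compared termwise
  with expressions involving both bases.\<close>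

lemma mexp_inner_self:
  fixes Y :: "real^'n^'n" and v :: "'n \<Rightarrow> real^'n"
  assumes ua: "eigensystem Y u a" and ov: "orthonormal v"
  shows "mexp Y \<bullet> Y = (\<Sum>i\<in>UNIV. \<Sum>j\<in>UNIV. (u i \<bullet> v j)\<^sup>2 * (exp (a i) * a i))"
proof -
  note ou = eigensystem_orthonormal[OF ua]
  have "mexp Y \<bullet> Y = (\<Sum>i\<in>UNIV. exp (a i) * a i)"
    by (subst eigensystem_inner[OF eigensystem_mexp[OF ua] ua])
      (simp add: orthonormalD[OF ou] if_distrib[where f="\<lambda>x. x * _"] if_distrib[where f="\<lambda>x. x ^ _"] cong: if_cong)
  also have "\<dots> = (\<Sum>i\<in>UNIV. \<Sum>j\<in>UNIV. (u i \<bullet> v j)\<^sup>2 * (exp (a i) * a i))"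
    by (simp add: sum_distrib_right[symmetric] orthonormal_sum_squares[OF ov] orthonormalD[OF ou])
  finally show ?thesis .
qed

text \<open>Klein's inequality, equivalently the Gibbs variational principle: after expansion in the two
  eigenbases it is the tangent line inequality \<open>exp a (1 + (b - a)) \<le> exp b\<close> for each pair of
  eigenvalues.\<close>

lemma mexp_gibbs_inequality:
  assumes "transpose X = X" "transpose Y = Y"
  shows "mexp Y \<bullet> (X - Y) + trace (mexp Y) \<le> trace (mexp X)"
proof -
  obtain u a where ua: "eigensystem Y u a" using symmetric_eigensystem[OF assms(2)] .
  obtain v b where vb: "eigensystem X v b" using symmetric_eigensystem[OF assms(1)] .
  note ou = eigensystem_orthonormal[OF ua] and ov = eigensystem_orthonormal[OF vb]
  have "trace (mexp X) - trace (mexp Y) - mexp Y \<bullet> (X - Y) =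
      (\<Sum>i\<in>UNIV. \<Sum>j\<in>UNIV. (u i \<bullet> v j)\<^sup>2 * (exp (b j) - exp (a i) - exp (a i) * b j + exp (a i) * a i))"
    unfolding inner_diff_right mexp_inner_self[OF ua ov] eigensystem_inner[OF eigensystem_mexp[OF ua] vb]
      eigensystem_trace_left[OF eigensystem_mexp[OF ua] ov] eigensystem_trace_right[OF eigensystem_mexp[OF vb] ou]
    by (simp add: sum_subtractf[symmetric] sum.distrib[symmetric] algebra_simps)
  also have "\<dots> \<ge> 0"
  proof (intro sum_nonneg mult_nonneg_nonneg zero_le_power2)
    fix i j
    have "exp (a i) * (1 + (b j - a i)) \<le> exp (a i) * exp (b j - a i)"
      by (intro mult_left_mono exp_ge_add_one_self) auto
    then show "0 \<le> exp (b j) - exp (a i) - exp (a i) * b j + exp (a i) * a i"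
      by (simp add: exp_diff algebra_simps)
  qed
  finally show ?thesis by simp
qed

section \<open>A variational lower bound for relative entropy\<close>

lemma inner_matrix_mul_left: "(P :: real^'n^'m) \<bullet> (A ** W) = (transpose A ** P) \<bullet> W"
proof -
  have "P \<bullet> (A ** W) = (\<Sum>i\<in>UNIV. \<Sum>j\<in>UNIV. \<Sum>k\<in>UNIV. P$i$j * A$i$k * W$k$j)"
    by (simp add: inner_vec_def matrix_matrix_mult_def sum_distrib_left mult_ac)
  also have "\<dots> = (\<Sum>k\<in>UNIV. \<Sum>j\<in>UNIV. \<Sum>i\<in>UNIV. P$i$j * A$i$k * W$k$j)"
    by (subst sum.swap, subst (2) sum.swap, subst sum.swap) (rule refl)
  also have "\<dots> = (transpose A ** P) \<bullet> W"
    unfolding inner_vec_def matrix_matrix_mult_def transpose_def inner_real_def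
    by (simp add: sum_distrib_left mult_ac)
  finally show ?thesis .
qed

lemma inner_transpose: "transpose (P :: real^'n^'m) \<bullet> transpose Q = P \<bullet> Q"
  unfolding inner_vec_def transpose_def by (simp, subst sum.swap, rule refl)

lemma inner_matrix_mul_right: "(P :: real^'n^'m) \<bullet> (W ** B) = (P ** transpose B) \<bullet> W"
proof -
  have "P \<bullet> (W ** B) = transpose P \<bullet> (transpose B ** transpose W)"
    using inner_transpose[of P "W ** B"] by (simp add: matrix_transpose_mul)
  also have "\<dots> = transpose (P ** transpose B) \<bullet> transpose W"
    by (simp add: inner_matrix_mul_left matrix_transpose_mul)
  finally show ?thesis by (simp only: inner_transpose)
qed

text \<open>For positive scalars, \<open>2 a w - (t a + b) w\<^sup>2\<close> has maximum \<open>a\<^sup>2 / (t a + b)\<close> at \<open>w = a / (t a + b)\<close>.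
  The form below is the matrix version, linear in the pair \<open>(A, B)\<close>; its maximizer solves
  \<open>t A W + W B = A\<close> and is written down in the eigenbases of \<open>A\<close> and \<open>B\<close>.\<close>

definition dual_form :: "real \<Rightarrow> real^'n^'n \<Rightarrow> real^'n^'n \<Rightarrow> real^'n^'n \<Rightarrow> real" where
  "dual_form t W A B = 2 * (A \<bullet> W) - t * (W \<bullet> (A ** W)) - W \<bullet> (W ** B)"

definition dual_optimizer ::
  "('n \<Rightarrow> real^'n) \<Rightarrow> ('n \<Rightarrow> real) \<Rightarrow> ('n \<Rightarrow> real^'n) \<Rightarrow> ('n \<Rightarrow> real) \<Rightarrow> real \<Rightarrow> real^'n^'n" where
  "dual_optimizer u a v b t =
     (\<Sum>i\<in>UNIV. \<Sum>j\<in>UNIV. (a i * (u i \<bullet> v j) / (t * a i + b j)) *\<^sub>R outer (u i) (v j))"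

text \<open>In the coordinates \<open>u i \<bullet> (W v j)\<close> the multiplications by \<open>A\<close> from the left and by \<open>B\<close> from the right
  are simultaneously diagonal, so the form decouples into scalar quadratics.\<close>

lemma dual_form_coordinates:
  assumes A: "eigensystem A u a" and B: "eigensystem B v b"
  shows "dual_form t W A B = (\<Sum>i\<in>UNIV. \<Sum>j\<in>UNIV.
     2 * (a i * (u i \<bullet> v j)) * (u i \<bullet> (W *v v j)) - (t * a i + b j) * (u i \<bullet> (W *v v j))\<^sup>2)"
proof -
  note ou = eigensystem_orthonormal[OF A] and ov = eigensystem_orthonormal[OF B]
  have 1: "u i \<bullet> (A *v x) = a i * (u i \<bullet> x)" for i x
    using symmetric_inner[OF eigensystem_symmetric[OF A], of "u i" x]
    by (simp add: eigensystem_eq[OF A])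
  have 2: "u i \<bullet> ((W ** B) *v v j) = b j * (u i \<bullet> (W *v v j))" for i j
    by (simp add: matrix_vector_mul_assoc[symmetric] eigensystem_eq[OF B] matrix_vector_mult_scaleR)
  show ?thesis
    unfolding dual_form_def inner_matrix_orthonormal[OF ou ov] sum_distrib_left sum_subtractf[symmetric]
      matrix_vector_mul_assoc[symmetric] 1 
    unfolding matrix_vector_mul_assoc 2
    by (intro sum.cong refl) (simp add: power2_eq_square algebra_simps)
qed

lemma dual_form_le:
  assumes A: "eigensystem A u a" and B: "eigensystem B v b"
    and pos: "\<And>i. a i > 0" "\<And>j. b j > 0" "t \<ge> 0"
  shows "dual_form t W A B \<le> (\<Sum>i\<in>UNIV. \<Sum>j\<in>UNIV. (u i \<bullet> v j)\<^sup>2 * ((a i)\<^sup>2 / (t * a i + b j)))"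
  unfolding dual_form_coordinates[OF A B]
proof (intro sum_mono)
  fix i j
  define d where "d = t * a i + b j"
  have d: "d > 0" unfolding d_def using pos by (simp add: add_nonneg_pos less_imp_le)
  define c where "c = a i * (u i \<bullet> v j)"
  define w where "w = u i \<bullet> (W *v v j)"
  have "0 \<le> (c - d * w)\<^sup>2 / d" using d by simp
  also have "\<dots> = c\<^sup>2 / d - (2 * c * w - d * w\<^sup>2)"
    using d by (simp add: power2_eq_square field_simps)
  finally show "2 * (a i * (u i \<bullet> v j)) * (u i \<bullet> (W *v v j)) - (t * a i + b j) * (u i \<bullet> (W *v v j))\<^sup>2
      \<le> (u i \<bullet> v j)\<^sup>2 * ((a i)\<^sup>2 / (t * a i + b j))"
    by (simp add: c_def d_def w_def power_mult_distrib mult_ac)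
qed

lemma dual_form_optimizer:
  assumes A: "eigensystem A u a" and B: "eigensystem B v b"
    and pos: "\<And>i. a i > 0" "\<And>j. b j > 0" "t \<ge> 0"
  shows "dual_form t (dual_optimizer u a v b t) A B
    = (\<Sum>i\<in>UNIV. \<Sum>j\<in>UNIV. (u i \<bullet> v j)\<^sup>2 * ((a i)\<^sup>2 / (t * a i + b j)))"
  unfolding dual_form_coordinates[OF A B]
proof (intro sum.cong refl)
  fix i j
  define d where "d = t * a i + b j"
  have d: "d > 0" unfolding d_def using pos by (simp add: add_nonneg_pos less_imp_le)
  have "dual_optimizer u a v b t *v v j = (\<Sum>i\<in>UNIV. (a i * (u i \<bullet> v j) / (t * a i + b j)) *\<^sub>R u i)"
    by (simp add: dual_optimizer_def sum_matrix_vector_mult scaleR_matrix_vector_assoc[symmetric]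
      outer_mult_vec orthonormalD[OF eigensystem_orthonormal[OF B]]
      if_distrib[where f="\<lambda>x. x *\<^sub>R _"] if_distrib[where f="\<lambda>x. _ *\<^sub>R x"] cong: if_cong)
  then have "u i \<bullet> (dual_optimizer u a v b t *v v j) = a i * (u i \<bullet> v j) / d"
    by (simp add: orthonormalD[OF eigensystem_orthonormal[OF A]] inner_sum_right
      if_distrib[where f="\<lambda>x. _ * x"] d_def cong: if_cong)
  then have w: "u i \<bullet> (dual_optimizer u a v b t *v v j) = a i * (u i \<bullet> v j) / (t * a i + b j)"
    by (simp add: d_def)
  show "2 * (a i * (u i \<bullet> v j)) * (u i \<bullet> (dual_optimizer u a v b t *v v j))
      - (t * a i + b j) * (u i \<bullet> (dual_optimizer u a v b t *v v j))\<^sup>2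
      = (u i \<bullet> v j)\<^sup>2 * ((a i)\<^sup>2 / (t * a i + b j))"
    unfolding w d_def[symmetric] using d by (simp add: power2_eq_square field_simps)
qed

text \<open>The linear dependence on \<open>(A, B)\<close> made explicit. The coefficient of \<open>B\<close> is minus a positive
  semidefinite matrix, which later makes the bound monotone in \<open>B\<close>.\<close>

lemma dual_form_linear:
  "dual_form t W A B = A \<bullet> (2 *\<^sub>R W - t *\<^sub>R (W ** transpose W)) - B \<bullet> (transpose W ** W)"
proof -
  have "W \<bullet> (A ** W) = A \<bullet> (W ** transpose W)"
    using inner_matrix_mul_right[of A W "transpose W"] by (simp add: inner_commute)
  moreover have "W \<bullet> (W ** B) = B \<bullet> (transpose W ** W)"
    using inner_matrix_mul_left[of B "transpose W" W] by (simp add: inner_commute)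
  ultimately show ?thesis by (simp add: dual_form_def inner_diff_right)
qed

text \<open>The integral that turns rational functions of the eigenvalues into logarithms.\<close>

lemma integral_dual_bound:
  fixes a b :: "'n::finite \<Rightarrow> real"
  assumes pos: "\<And>i. a i > 0" "\<And>j. b j > 0" and N: "N > 0"
  shows "((\<lambda>t. \<Sum>i\<in>UNIV. \<Sum>j\<in>UNIV. p i j * ((a i)\<^sup>2 / (t * a i + b j))) has_integral
     (\<Sum>i\<in>UNIV. \<Sum>j\<in>UNIV. p i j * (a i * (ln (N * a i + b j) - ln (b j))))) {0..N}"
proof (rule has_integral_sum[OF finite_class.finite_UNIV], rule has_integral_sum[OF finite_class.finite_UNIV],
    rule has_integral_mult_right)
  fix i j
  have der: "((\<lambda>t. t * a i + b j) has_real_derivative a i) (at t within {0..N})" for t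
    by (auto intro!: derivative_eq_intros)
  have "((\<lambda>t. (a i)\<^sup>2 / (t * a i + b j)) has_integral (a i * ln (N * a i + b j) - a i * ln (0 * a i + b j))) {0..N}"
  proof (rule fundamental_theorem_of_calculus)
    fix t assume "t \<in> {0..N}"
    then have pt: "t * a i + b j > 0" using pos(1)[of i] pos(2)[of j] by (simp add: add_nonneg_pos less_imp_le)
    show "((\<lambda>t. a i * ln (t * a i + b j)) has_vector_derivative (a i)\<^sup>2 / (t * a i + b j)) (at t within {0..N})"
      unfolding has_real_derivative_iff_has_vector_derivative[symmetric]
      using DERIV_cmult[OF DERIV_chain2[OF DERIV_ln_divide[OF pt] der], of "a i"]
      by (simp add: power2_eq_square)
  qed (use N in simp)
  then show "((\<lambda>t. (a i)\<^sup>2 / (t * a i + b j)) has_integral (a i * (ln (N * a i + b j) - ln (b j)))) {0..N}"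
    by (simp add: algebra_simps)
qed

lemma dual_optimizer_continuous:
  assumes pos: "\<And>i. a i > 0" "\<And>j. b j > 0"
  shows "continuous_on {0..N} (dual_optimizer u a v b)"
proof -
  have "t * a i + b j \<noteq> 0" if "t \<in> {0..N}" for t i j
  proof -
    have "0 < t * a i + b j"
      using pos(1)[of i] pos(2)[of j] that by (simp add: add_nonneg_pos less_imp_le)
    then show ?thesis by simp
  qed
  then have "continuous_on {0..N} (\<lambda>t. (a i * (u i \<bullet> v j) / (t * a i + b j)) *\<^sub>R outer (u i) (v j))" for i j
    by (intro continuous_on_scaleR continuous_on_divide continuous_on_add continuous_on_mult
        continuous_on_const continuous_on_id) auto
  then show ?thesis
    unfolding dual_optimizer_def[abs_def] by (intro continuous_on_sum)
qed

lemma continuous_on_matrix_mult: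
  fixes f :: "'a::topological_space \<Rightarrow> real^'n^'m" and g :: "'a \<Rightarrow> real^'k^'n"
  assumes "continuous_on S f" "continuous_on S g"
  shows "continuous_on S (\<lambda>x. f x ** g x)"
  unfolding matrix_matrix_mult_def using assms
  by (intro continuous_intros) auto

lemma continuous_on_transpose:
  fixes f :: "'a::topological_space \<Rightarrow> real^'n^'m"
  assumes "continuous_on S f"
  shows "continuous_on S (\<lambda>x. transpose (f x))"
  unfolding transpose_def using assms by (intro continuous_intros) auto

text \<open>Truncating the integral at \<open>N\<close> costs at most \<open>b / N\<close>, and the divergent part \<open>a ln N\<close> depends on \<open>a\<close>
  only.\<close>

lemma ln_entropy_bounds:
  fixes a b N :: real
  assumes "a > 0" "b > 0" "N > 0"
  shows "a * (ln N + ln a - ln b) \<le> a * (ln (N * a + b) - ln b)"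
    and "a * (ln (N * a + b) - ln b) \<le> a * (ln N + ln a - ln b) + b / N"
proof -
  have e: "ln (N * a + b) = ln N + ln a + ln (1 + b / (N * a))"
  proof -
    have "N * a + b = (N * a) * (1 + b / (N * a))" using assms by (simp add: field_simps)
    moreover have "0 < 1 + b / (N * a)" using assms by (simp add: add_pos_pos)
    ultimately have "ln (N * a + b) = ln (N * a) + ln (1 + b / (N * a))"
      using assms by (simp only: ln_mult_pos mult_pos_pos)
    then show ?thesis using assms by (simp only: ln_mult_pos)
  qed
  define r where "r = ln (1 + b / (N * a))"
  have "0 \<le> a * r" using assms by (simp add: r_def)
  then show "a * (ln N + ln a - ln b) \<le> a * (ln (N * a + b) - ln b)"
    unfolding e r_def[symmetric] by (simp add: algebra_simps)
  have "r \<le> b / (N * a)" unfolding r_def using assms by (intro ln_add_one_self_le_self) simp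
  then have "a * r \<le> a * (b / (N * a))" using assms by (intro mult_left_mono) auto
  then show "a * (ln (N * a + b) - ln b) \<le> a * (ln N + ln a - ln b) + b / N"
    using assms unfolding e r_def[symmetric] by (simp add: algebra_simps)
qed

text \<open>A supporting functional of relative entropy at \<open>(exp Y0, exp X0)\<close>. Its coefficients are the
  integrals of the linear forms belonging to the optimal \<open>W\<close> at that pair, for each \<open>t\<close> in
  \<open>{0..N}\<close>. Arguments are given as exponentials so that \<open>D(exp Y, exp X)\<close> is simply
  \<open>mexp Y \<bullet> (Y - X)\<close>; the truncation error \<open>trace (mexp X) / N\<close> appears on one side only.\<close>

lemma relative_entropy_tangent:
  fixes Y0 X0 :: "real^'n^'n"
  assumes Y0: "transpose Y0 = Y0" and X0: "transpose X0 = X0" and N: "N > 0"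
  obtains P G where "transpose G = G" "\<And>x. x \<bullet> (G *v x) \<ge> 0"
    "\<And>Y X. transpose Y = Y \<Longrightarrow> transpose X = X \<Longrightarrow>
       mexp Y \<bullet> P - mexp X \<bullet> G \<le> mexp Y \<bullet> (Y - X) + ln N * trace (mexp Y) + trace (mexp X) / N"
    "mexp Y0 \<bullet> (Y0 - X0) + ln N * trace (mexp Y0) \<le> mexp Y0 \<bullet> P - mexp X0 \<bullet> G"
proof -
  obtain u0 a0 where ua0: "eigensystem Y0 u0 a0" using symmetric_eigensystem[OF Y0] .
  obtain v0 b0 where vb0: "eigensystem X0 v0 b0" using symmetric_eigensystem[OF X0] .
  define W where "W = dual_optimizer u0 (\<lambda>i. exp (a0 i)) v0 (\<lambda>i. exp (b0 i))"
  have W: "continuous_on {0..N} W"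
    unfolding W_def by (rule dual_optimizer_continuous) auto
  define p where "p t = 2 *\<^sub>R W t - t *\<^sub>R (W t ** transpose (W t))" for t
  define g where "g t = transpose (W t) ** W t" for t
  define P where "P = integral {0..N} p"
  define G where "G = integral {0..N} g"
  have pP: "(p has_integral P) {0..N}"
    unfolding P_def p_def
    by (intro integrable_integral integrable_continuous_real continuous_intros
        continuous_on_matrix_mult continuous_on_transpose W)
  have gG: "(g has_integral G) {0..N}"
    unfolding G_def g_def
    by (intro integrable_integral integrable_continuous_real
        continuous_on_matrix_mult continuous_on_transpose W)
  have lin: "((\<lambda>t. dual_form t (W t) A B) has_integral (A \<bullet> P - B \<bullet> G)) {0..N}" for A B
    unfolding dual_form_linear p_def[symmetric] g_def[symmetric]
    by (intro has_integral_diff has_integral_linear[OF pP bounded_linear_inner_right, unfolded o_def]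
        has_integral_linear[OF gG bounded_linear_inner_right, unfolded o_def])
  have "transpose G = G"
  proof -
    have "transpose (g t) = g t" for t by (simp add: g_def matrix_transpose_mul)
    moreover have "((\<lambda>t. transpose (g t)) has_integral transpose G) {0..N}"
      using has_integral_linear[OF gG linear_conv_bounded_linear[THEN iffD1, OF linear_transpose]]
      by (simp add: o_def)
    ultimately have "(g has_integral transpose G) {0..N}" by simp
    then show ?thesis using gG by (rule has_integral_unique)
  qed
  moreover have "x \<bullet> (G *v x) \<ge> 0" for x
  proof -
    have "((\<lambda>t. x \<bullet> (g t *v x)) has_integral (x \<bullet> (G *v x))) {0..N}"
      unfolding inner_matrix_vector
      using has_integral_linear[OF gG bounded_linear_inner_left] by (simp add: o_def)
    moreover have "x \<bullet> (g t *v x) \<ge> 0" for t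
    proof -
      have "x \<bullet> (g t *v x) = (W t *v x) \<bullet> (W t *v x)"
        by (metis g_def dot_lmul_matrix inner_commute matrix_vector_mul_assoc transpose_matrix_vector)
      then show ?thesis by simp
    qed
    ultimately show ?thesis by (rule has_integral_nonneg) 
  qed
  moreover have "mexp Y \<bullet> P - mexp X \<bullet> G \<le> mexp Y \<bullet> (Y - X) + ln N * trace (mexp Y) + trace (mexp X) / N"
    if Y: "transpose Y = Y" and X: "transpose X = X" for Y X
  proof -
    obtain u a where ua: "eigensystem Y u a" using symmetric_eigensystem[OF Y] .
    obtain v b where vb: "eigensystem X v b" using symmetric_eigensystem[OF X] .
    have "mexp Y \<bullet> P - mexp X \<bullet> G \<le> (\<Sum>i\<in>UNIV. \<Sum>j\<in>UNIV. (u i \<bullet> v j)\<^sup>2 *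
        (exp (a i) * (ln (N * exp (a i) + exp (b j)) - ln (exp (b j)))))"
      by (rule has_integral_le[OF lin integral_dual_bound[OF exp_gt_zero exp_gt_zero N]],
          rule dual_form_le[OF eigensystem_mexp[OF ua] eigensystem_mexp[OF vb]]) simp_all
    also have "\<dots> \<le> (\<Sum>i\<in>UNIV. \<Sum>j\<in>UNIV. (u i \<bullet> v j)\<^sup>2 *
        (exp (a i) * (ln N + ln (exp (a i)) - ln (exp (b j))) + exp (b j) / N))"
      using N by (intro sum_mono mult_left_mono ln_entropy_bounds) auto
    also have "\<dots> = mexp Y \<bullet> (Y - X) + ln N * trace (mexp Y) + trace (mexp X) / N"
      unfolding inner_diff_right mexp_inner_self[OF ua eigensystem_orthonormal[OF vb]]
        eigensystem_inner[OF eigensystem_mexp[OF ua] vb]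
        eigensystem_trace_left[OF eigensystem_mexp[OF ua] eigensystem_orthonormal[OF vb]]
        eigensystem_trace_right[OF eigensystem_mexp[OF vb] eigensystem_orthonormal[OF ua]]
        sum_distrib_left sum_divide_distrib sum_subtractf[symmetric] sum.distrib[symmetric]
      by (intro sum.cong refl) (simp add: algebra_simps)
    finally show ?thesis .
  qed
  moreover have "mexp Y0 \<bullet> (Y0 - X0) + ln N * trace (mexp Y0) \<le> mexp Y0 \<bullet> P - mexp X0 \<bullet> G"
  proof -
    have "mexp Y0 \<bullet> (Y0 - X0) + ln N * trace (mexp Y0) = (\<Sum>i\<in>UNIV. \<Sum>j\<in>UNIV. (u0 i \<bullet> v0 j)\<^sup>2 *
        (exp (a0 i) * (ln N + ln (exp (a0 i)) - ln (exp (b0 j)))))"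
      unfolding inner_diff_right mexp_inner_self[OF ua0 eigensystem_orthonormal[OF vb0]]
        eigensystem_inner[OF eigensystem_mexp[OF ua0] vb0]
        eigensystem_trace_left[OF eigensystem_mexp[OF ua0] eigensystem_orthonormal[OF vb0]]
        sum_distrib_left sum_subtractf[symmetric] sum.distrib[symmetric]
      by (intro sum.cong refl) (simp add: algebra_simps)
    also have "\<dots> \<le> (\<Sum>i\<in>UNIV. \<Sum>j\<in>UNIV. (u0 i \<bullet> v0 j)\<^sup>2 *
        (exp (a0 i) * (ln (N * exp (a0 i) + exp (b0 j)) - ln (exp (b0 j)))))"
      using N by (intro sum_mono mult_left_mono ln_entropy_bounds) auto
    also have "\<dots> \<le> mexp Y0 \<bullet> P - mexp X0 \<bullet> G"
    proof (rule has_integral_le[OF integral_dual_bound[OF exp_gt_zero exp_gt_zero N] lin])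
      fix t assume "t \<in> {0..N}"
      then show "(\<Sum>i\<in>UNIV. \<Sum>j\<in>UNIV. (u0 i \<bullet> v0 j)\<^sup>2 * ((exp (a0 i))\<^sup>2 / (t * exp (a0 i) + exp (b0 j))))
        \<le> dual_form t (W t) (mexp Y0) (mexp X0)"
        unfolding W_def
        by (subst dual_form_optimizer[OF eigensystem_mexp[OF ua0] eigensystem_mexp[OF vb0]]) simp_all
    qed
    finally show ?thesis .
  qed
  ultimately show ?thesis by (rule that)
qed

lemma inner_psd_mono:
  fixes A B G :: "real^'n^'n"
  assumes "transpose G = G" "\<And>x. x \<bullet> (G *v x) \<ge> 0" "\<And>x. x \<bullet> (A *v x) \<le> x \<bullet> (B *v x)"
  shows "A \<bullet> G \<le> B \<bullet> G"
proof -
  obtain w c where wc: "eigensystem G w c" using symmetric_eigensystem[OF assms(1)] .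
  note ow = eigensystem_orthonormal[OF wc]
  have c: "c i \<ge> 0" for i
    using assms(2)[of "w i"] by (simp add: eigensystem_eq[OF wc] orthonormalD[OF ow])
  have e: "M \<bullet> G = (\<Sum>i\<in>UNIV. c i * (w i \<bullet> (M *v w i)))" for M
    by (subst eigensystem_expand[OF wc]) (simp add: inner_sum_right inner_matrix_vector)
  show ?thesis unfolding e by (intro sum_mono mult_left_mono assms(3) c)
qed

section \<open>Jensen inequality for the trace exponential\<close>

lemma mexp_measurable [measurable]: "mexp \<in> borel_measurable (borel :: (real^'n^'n) measure)"
proof -
  have "continuous_on UNIV (\<lambda>A. mpow A k :: real^'n^'n)" for k
    by (induction k) (auto intro: continuous_on_matrix_mult continuous_intros)
  then have [measurable]: "(\<lambda>A. mpow A k :: real^'n^'n) \<in> borel_measurable borel" for k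
    by (rule borel_measurable_continuous_onI)
  show ?thesis unfolding mexp_def[abs_def] by measurable
qed

lemma trace_measurable [measurable]: "trace \<in> borel_measurable (borel :: (real^'n^'n) measure)"
  unfolding trace_inner_mat_1[abs_def] by measurable

text \<open>A bound on the operator norm, stated pointwise: it passes to sums and products at once and
  carries over almost surely to random matrices.\<close>

definition opbound :: "real \<Rightarrow> real^'n^'m \<Rightarrow> bool" where
  "opbound c A \<longleftrightarrow> (\<forall>x. norm (A *v x) \<le> c * norm x)"

lemma opboundD: "opbound c A \<Longrightarrow> norm (A *v x) \<le> c * norm x"
  by (simp add: opbound_def)

lemma opbound_mono: "opbound c A \<Longrightarrow> c \<le> d \<Longrightarrow> opbound d A"
  unfolding opbound_def by (meson mult_right_mono norm_ge_zero order_trans)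

lemma opbound_exists: "\<exists>c. opbound c A"
  using bounded_linear.bounded[OF matrix_vector_mul_bounded_linear[of A]]
  by (auto simp: opbound_def mult.commute)

lemma opbound_add: "opbound c A \<Longrightarrow> opbound d B \<Longrightarrow> opbound (c + d) (A + B)"
  unfolding opbound_def
proof
  fix x assume "\<forall>x. norm (A *v x) \<le> c * norm x" "\<forall>x. norm (B *v x) \<le> d * norm x"
  then have "norm (A *v x) + norm (B *v x) \<le> c * norm x + d * norm x" by (intro add_mono) auto
  then show "norm ((A + B) *v x) \<le> (c + d) * norm x"
    using norm_triangle_ineq[of "A *v x" "B *v x"]
    by (simp add: matrix_vector_mult_add_rdistrib distrib_right)
qed

lemma opbound_scaleR: "opbound c A \<Longrightarrow> r \<ge> 0 \<Longrightarrow> opbound (r * c) (r *\<^sub>R A)"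
  unfolding opbound_def
  by (auto simp: scaleR_matrix_vector_assoc[symmetric] mult.assoc intro: mult_left_mono)

lemma eigensystem_opbound:
  assumes "eigensystem A u a" "opbound c A"
  shows "\<bar>a i\<bar> \<le> c"
  using opboundD[OF assms(2), of "u i"] orthonormal_norm[OF eigensystem_orthonormal[OF assms(1)]]
  by (simp add: eigensystem_eq[OF assms(1)])

lemma eigensystem_norm_le:
  assumes A: "eigensystem (A :: real^'n^'n) u a" and a: "\<And>i. \<bar>a i\<bar> \<le> c"
  shows "norm A \<le> real CARD('n) * c"
proof -
  have 1: "norm (outer (u i) (u i)) = 1" for i
    using orthonormalD[OF eigensystem_orthonormal[OF A]]
    by (simp add: norm_eq_1 inner_matrix_vector[symmetric] outer_mult_vec)
  have "norm A \<le> (\<Sum>i\<in>UNIV. norm (a i *\<^sub>R outer (u i) (u i)))"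
    by (subst eigensystem_expand[OF A]) (rule norm_sum)
  also have "\<dots> \<le> (\<Sum>i\<in>(UNIV::'n set). c)" by (intro sum_mono) (simp add: 1 a)
  finally show ?thesis by simp
qed

lemma symmetric_opbound_norm_le:
  assumes "transpose A = A" "opbound c (A :: real^'n^'n)"
  shows "norm A \<le> real CARD('n) * c"
  using symmetric_eigensystem[OF assms(1)] eigensystem_norm_le eigensystem_opbound assms(2) by metis

lemma mexp_opbound_norm_le:
  assumes "transpose A = A" "opbound c (A :: real^'n^'n)"
  shows "norm (mexp A) \<le> real CARD('n) * exp c"
proof -
  obtain u a where ua: "eigensystem A u a" using symmetric_eigensystem[OF assms(1)] .
  have "a i \<le> c" for i using eigensystem_opbound[OF ua assms(2), of i] by simp
  then show ?thesis by (intro eigensystem_norm_le[OF eigensystem_mexp[OF ua]]) simp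
qed

text \<open>Uniform positive definiteness, which survives taking expectations and allows the logarithm of
  an expected exponential to be formed.\<close>

lemma mexp_lower_bound:
  assumes "transpose A = A" "opbound c (A :: real^'n^'n)"
  shows "exp (- c) * (x \<bullet> x) \<le> x \<bullet> (mexp A *v x)"
proof -
  obtain u a where ua: "eigensystem A u a" using symmetric_eigensystem[OF assms(1)] .
  have "- c \<le> a i" for i using eigensystem_opbound[OF ua assms(2), of i] by simp
  then show ?thesis
    unfolding orthonormal_sum_squares[OF eigensystem_orthonormal[OF ua], symmetric]
      eigensystem_quadratic[OF eigensystem_mexp[OF ua]] sum_distrib_left
    by (intro sum_mono mult_right_mono) auto
qed

lemma mexp_symmetric: "transpose A = A \<Longrightarrow> transpose (mexp A) = mexp A"
  by (metis symmetric_eigensystem eigensystem_mexp eigensystem_symmetric)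

lemma trace_mexp_pos: "transpose A = A \<Longrightarrow> 0 < trace (mexp (A :: real^'n^'n))"
proof -
  assume "transpose A = A"
  then obtain u a where ua: "eigensystem A u a" using symmetric_eigensystem by blast
  show ?thesis unfolding eigensystem_trace[OF eigensystem_mexp[OF ua]] by (intro sum_pos) auto
qed

lemma transpose_add: "transpose (A + B) = transpose A + transpose (B :: real^'n^'m)"
  by (rule linear_add[OF linear_transpose])

lemma transpose_scaleR: "transpose (c *\<^sub>R A) = c *\<^sub>R transpose (A :: real^'n^'m)"
  by (rule linear_cmul[OF linear_transpose])

lemma transpose_sum: "transpose (sum A I) = (\<Sum>i\<in>I. transpose (A i :: real^'n^'m))"
  by (rule linear_sum[OF linear_transpose])

lemma integral_transpose:
  fixes X :: "'a \<Rightarrow> real^'n^'m"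
  assumes "integrable M X"
  shows "integral\<^sup>L M (\<lambda>\<omega>. transpose (X \<omega>)) = transpose (integral\<^sup>L M X)"
  using integral_bounded_linear[OF linear_conv_bounded_linear[THEN iffD1, OF linear_transpose] assms] .

context prob_space
begin

lemma integrable_mexp:
  fixes X :: "'a \<Rightarrow> real^'n^'n"
  assumes [measurable]: "X \<in> borel_measurable M" and "\<And>\<omega>. transpose (X \<omega>) = X \<omega>"
    and "AE \<omega> in M. opbound c (X \<omega>)"
  shows "integrable M (\<lambda>\<omega>. mexp (X \<omega>))"
proof (rule integrable_const_bound[where B="real CARD('n) * exp c"])
  show "AE \<omega> in M. norm (mexp (X \<omega>)) \<le> real CARD('n) * exp c"
    using assms(3) by eventually_elim (rule mexp_opbound_norm_le[OF assms(2)])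
qed measurable

text \<open>The Jensen inequality behind Lieb's theorem. Write \<open>T = exp (H + X)\<close> and \<open>E T = exp Y0\<close>. The tangent
  functional of relative entropy at \<open>(E T, exp K)\<close>, evaluated at the random pair \<open>(T, exp X)\<close>, where the
  entropy equals \<open>T \<bullet> H\<close>, gives after integration \<open>E T \<bullet> (Y0 - K - H) \<le> 0\<close>; here the semidefinite
  assumption enters through the sign of the coefficient \<open>G\<close>. The Gibbs inequality converts this into
  the comparison of traces.\<close>

theorem trace_mexp_jensen:
  fixes X :: "'a \<Rightarrow> real^'n^'n"
  assumes X [measurable]: "X \<in> borel_measurable M" and sym: "\<And>\<omega>. transpose (X \<omega>) = X \<omega>"
    and bd: "AE \<omega> in M. opbound c (X \<omega>)"
    and H: "transpose H = H" and K: "transpose K = K"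
    and le: "\<And>x. x \<bullet> (expectation (\<lambda>\<omega>. mexp (X \<omega>)) *v x) \<le> x \<bullet> (mexp K *v x)"
  shows "expectation (\<lambda>\<omega>. trace (mexp (H + X \<omega>))) \<le> trace (mexp (H + K))"
proof -
  define T where "T = (\<lambda>\<omega>. mexp (H + X \<omega>))"
  define B where "B = (\<lambda>\<omega>. mexp (X \<omega>))"
  obtain h where h: "opbound h H" using opbound_exists by blast
  have HX: "transpose (H + X \<omega>) = H + X \<omega>" for \<omega> by (simp add: transpose_add H sym)
  have bd': "AE \<omega> in M. opbound (h + c) (H + X \<omega>)"
    using bd by eventually_elim (rule opbound_add[OF h])
  have T: "integrable M T" unfolding T_def by (rule integrable_mexp[OF _ HX bd']) measurable
  have B: "integrable M B" unfolding B_def by (rule integrable_mexp[OF X sym bd])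
  define ET where "ET = expectation T"
  define EB where "EB = expectation B"
  have ET_inner: "expectation (\<lambda>\<omega>. T \<omega> \<bullet> C) = ET \<bullet> C" for C
    unfolding ET_def by (rule integral_inner_left[OF T])
  have EB_inner: "expectation (\<lambda>\<omega>. B \<omega> \<bullet> C) = EB \<bullet> C" for C
    unfolding EB_def by (rule integral_inner_left[OF B])
  have "transpose ET = ET"
    unfolding ET_def integral_transpose[OF T, symmetric] by (simp add: T_def mexp_symmetric HX)
  moreover have "x \<bullet> (ET *v x) > 0" if "x \<noteq> 0" for x
  proof -
    have "exp (- (h + c)) * (x \<bullet> x) = expectation (\<lambda>\<omega>. exp (- (h + c)) * (x \<bullet> x))"
      by (simp add: prob_space)
    also have "\<dots> \<le> expectation (\<lambda>\<omega>. x \<bullet> (T \<omega> *v x))"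
    proof (rule integral_mono_AE)
      show "integrable M (\<lambda>\<omega>. x \<bullet> (T \<omega> *v x))"
        unfolding inner_matrix_vector using T by simp
      show "AE \<omega> in M. exp (- (h + c)) * (x \<bullet> x) \<le> x \<bullet> (T \<omega> *v x)"
        using bd' unfolding T_def by eventually_elim (rule mexp_lower_bound[OF HX])
    qed simp
    also have "\<dots> = x \<bullet> (ET *v x)" unfolding inner_matrix_vector by (rule ET_inner)
    finally show ?thesis using that by (smt (verit) exp_gt_zero inner_gt_zero_iff mult_pos_pos)
  qed
  ultimately obtain Y0 where Y0: "transpose Y0 = Y0" "mexp Y0 = ET"
    using positive_definite_is_mexp by blast
  have key: "ET \<bullet> (Y0 - K - H) \<le> trace EB / N" if N: "N > 0" for N
  proof -
    obtain G P where G: "transpose G = G" "\<And>x. x \<bullet> (G *v x) \<ge> 0"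
      and upper: "\<And>Y X. transpose Y = Y \<Longrightarrow> transpose X = X \<Longrightarrow>
         mexp Y \<bullet> P - mexp X \<bullet> G \<le> mexp Y \<bullet> (Y - X) + ln N * trace (mexp Y) + trace (mexp X) / N"
      and lower: "mexp Y0 \<bullet> (Y0 - K) + ln N * trace (mexp Y0) \<le> mexp Y0 \<bullet> P - mexp K \<bullet> G"
    proof (rule relative_entropy_tangent[OF Y0(1) K N], goal_cases)
      case (1 P G)
      show ?case by (rule 1(1)[OF 1(2-5)])
    qed
    have "T \<omega> \<bullet> P - B \<omega> \<bullet> G \<le> T \<omega> \<bullet> H + ln N * (T \<omega> \<bullet> mat 1) + B \<omega> \<bullet> mat 1 / N" for \<omega>
      using upper[OF HX sym, of \<omega> \<omega>] by (simp add: T_def B_def trace_inner_mat_1)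
    then have "expectation (\<lambda>\<omega>. T \<omega> \<bullet> P - B \<omega> \<bullet> G)
        \<le> expectation (\<lambda>\<omega>. T \<omega> \<bullet> H + ln N * (T \<omega> \<bullet> mat 1) + B \<omega> \<bullet> mat 1 / N)"
      using T B by (intro integral_mono) auto
    then have 1: "ET \<bullet> P - EB \<bullet> G \<le> ET \<bullet> H + ln N * trace ET + trace EB / N"
      using T B by (simp add: ET_inner EB_inner trace_inner_mat_1)
    have "EB \<bullet> G \<le> mexp K \<bullet> G"
      using G le unfolding EB_def B_def by (intro inner_psd_mono) auto
    with 1 lower show ?thesis by (simp add: Y0 inner_diff_right)
  qed
  define D where "D = ET \<bullet> (Y0 - K - H)"
  have "D \<le> 0"
  proof (rule ccontr)
    assume "\<not> D \<le> 0"
    then have D: "D > 0" by simp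
    \<comment> \<open>A truncation level \<open>N = y / D\<close> so large that the error \<open>trace EB / N\<close> falls below \<open>D\<close>.\<close>
    define y where "y = \<bar>trace EB\<bar> + 1"
    have y: "y > 0" by (simp add: y_def)
    have "D \<le> trace EB / (y / D)"
      unfolding D_def by (rule key) (use D y in \<open>simp add: D_def\<close>)
    then have "D * y \<le> D * trace EB" using D y by (simp add: field_simps)
    then have "y \<le> trace EB" by (simp only: mult_le_cancel_left_pos[OF D])
    then show False unfolding y_def by linarith
  qed
  moreover have "ET \<bullet> (H + K - Y0) + trace ET \<le> trace (mexp (H + K))"
    using mexp_gibbs_inequality[of "H + K" Y0] by (simp add: Y0 transpose_add H K)
  moreover have "expectation (\<lambda>\<omega>. trace (mexp (H + X \<omega>))) = trace ET"
    unfolding trace_inner_mat_1 T_def[symmetric] using ET_inner by (simp add: T_def)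
  ultimately show ?thesis by (simp add: D_def inner_diff_right inner_add_right)
qed

end

section \<open>The trace moment generating function of an independent sum\<close>

text \<open>Since \<open>(n + 2)! \<ge> 2 * 3\<^sup>n\<close>, the series of \<open>exp\<close> beyond the linear term is dominated by a geometric
  series of ratio \<open>c / 3\<close>. This is the source of the constant \<open>1/3\<close> in Bernstein's inequality.\<close>

lemma exp_le_bernstein:
  fixes y c :: real
  assumes y: "\<bar>y\<bar> \<le> c" and c: "c < 3"
  shows "exp y \<le> 1 + y + (1 / (2 * (1 - c / 3))) * y\<^sup>2"
proof -
  have c0: "c \<ge> 0" using y by simp
  have fact: "fact (n + 2) \<ge> (2 * 3 ^ n :: real)" for n
  proof (induction n)
    case (Suc n)
    have "(2 * 3 ^ Suc n :: real) = 3 * (2 * 3 ^ n)" by simp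
    also have "\<dots> \<le> 3 * fact (n + 2)" by (rule mult_left_mono[OF Suc]) simp
    also have "\<dots> \<le> real (Suc (n + 2)) * fact (n + 2)" by (intro mult_right_mono) auto
    also have "\<dots> = fact (Suc n + 2)" by (simp only: fact_Suc add_Suc)
    finally show ?case .
  qed simp
  have "(\<Sum>n. inverse (fact (n + 2)) *\<^sub>R y ^ (n + 2)) \<le> (\<Sum>n. (y\<^sup>2 / 2) * (c / 3) ^ n)"
  proof (rule suminf_le)
    fix n
    have "inverse (fact (n + 2)) *\<^sub>R y ^ (n + 2) \<le> inverse (fact (n + 2)) * \<bar>y ^ (n + 2)\<bar>"
      by (simp add: mult_left_mono)
    also have "\<dots> = inverse (fact (n + 2)) * (y\<^sup>2 * \<bar>y\<bar> ^ n)"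
      by (simp add: power_add power_abs power2_eq_square abs_mult)
    also have "\<dots> \<le> inverse (2 * 3 ^ n) * (y\<^sup>2 * c ^ n)"
    proof (rule mult_mono)
      show "inverse (fact (n + 2)) \<le> inverse (2 * 3 ^ n :: real)"
        using fact[of n] by (intro le_imp_inverse_le) auto
      show "y\<^sup>2 * \<bar>y\<bar> ^ n \<le> y\<^sup>2 * c ^ n"
        using y by (intro mult_left_mono power_mono) auto
    qed auto
    also have "\<dots> = (y\<^sup>2 / 2) * (c / 3) ^ n" by (simp add: power_divide field_simps)
    finally show "inverse (fact (n + 2)) *\<^sub>R y ^ (n + 2) \<le> (y\<^sup>2 / 2) * (c / 3) ^ n" .
  next
    show "summable (\<lambda>n. inverse (fact (n + 2)) *\<^sub>R y ^ (n + 2))"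
      using summable_ignore_initial_segment[OF summable_exp_generic[of y], of 2] by simp
    show "summable (\<lambda>n. (y\<^sup>2 / 2) * (c / 3) ^ n)"
      using c c0 by (intro summable_mult summable_geometric) simp
  qed
  also have "\<dots> = (y\<^sup>2 / 2) * (1 / (1 - c / 3))"
    using c c0 by (subst suminf_mult) (auto simp: summable_geometric suminf_geometric)
  also have "\<dots> = (1 / (2 * (1 - c / 3))) * y\<^sup>2" using c by (simp add: field_simps)
  finally show ?thesis using exp_first_two_terms[of y] by simp
qed

lemma eigensystem_square: "eigensystem A u a \<Longrightarrow> eigensystem (A ** A) u (\<lambda>i. (a i)\<^sup>2)"
  by (auto simp: eigensystem_def matrix_vector_mul_assoc[symmetric] matrix_vector_mult_scaleR power2_eq_square)

lemma mexp_le_bernstein: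
  assumes A: "transpose A = A" "opbound c A" "c < 3"
  shows "x \<bullet> (mexp A *v x) \<le> x \<bullet> x + x \<bullet> (A *v x) + (1 / (2 * (1 - c / 3))) * (x \<bullet> ((A ** A) *v x))"
proof -
  obtain u a where ua: "eigensystem A u a" using symmetric_eigensystem[OF A(1)] .
  have "(\<Sum>i\<in>UNIV. exp (a i) * (x \<bullet> u i)\<^sup>2)
      \<le> (\<Sum>i\<in>UNIV. (1 + a i + (1 / (2 * (1 - c / 3))) * (a i)\<^sup>2) * (x \<bullet> u i)\<^sup>2)"
    by (intro sum_mono mult_right_mono exp_le_bernstein eigensystem_opbound[OF ua A(2)] A(3)) auto
  then show ?thesis
    unfolding eigensystem_quadratic[OF eigensystem_mexp[OF ua]] eigensystem_quadratic[OF ua]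
      eigensystem_quadratic[OF eigensystem_square[OF ua]]
      orthonormal_sum_squares[OF eigensystem_orthonormal[OF ua], symmetric]
    by (simp add: algebra_simps sum.distrib sum_distrib_left)
qed

lemma mexp_ge_one_plus:
  assumes "transpose A = A"
  shows "x \<bullet> x + x \<bullet> (A *v x) \<le> x \<bullet> (mexp A *v x)"
proof -
  obtain u a where ua: "eigensystem A u a" using symmetric_eigensystem[OF assms] .
  have "(\<Sum>i\<in>UNIV. (1 + a i) * (x \<bullet> u i)\<^sup>2) \<le> (\<Sum>i\<in>UNIV. exp (a i) * (x \<bullet> u i)\<^sup>2)"
    by (intro sum_mono mult_right_mono exp_ge_add_one_self) auto
  then show ?thesis
    unfolding eigensystem_quadratic[OF eigensystem_mexp[OF ua]] eigensystem_quadratic[OF ua]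
      orthonormal_sum_squares[OF eigensystem_orthonormal[OF ua], symmetric]
    by (simp add: algebra_simps sum.distrib)
qed

lemma trace_mexp_le:
  fixes A :: "real^'n^'n"
  assumes "transpose A = A" "\<And>x. x \<bullet> (A *v x) \<le> c * (x \<bullet> x)"
  shows "trace (mexp A) \<le> real CARD('n) * exp c"
proof -
  obtain u a where ua: "eigensystem A u a" using symmetric_eigensystem[OF assms(1)] .
  have "a i \<le> c" for i
    using assms(2)[of "u i"] by (simp add: eigensystem_eq[OF ua] orthonormalD[OF eigensystem_orthonormal[OF ua]])
  then have "(\<Sum>i\<in>UNIV. exp (a i)) \<le> (\<Sum>i\<in>(UNIV::'n set). exp c)" by (intro sum_mono) simp
  then show ?thesis by (simp add: eigensystem_trace[OF eigensystem_mexp[OF ua]])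
qed

context prob_space
begin

lemma integrable_opbound:
  fixes X :: "'a \<Rightarrow> real^'n^'n"
  assumes [measurable]: "X \<in> borel_measurable M" and "\<And>\<omega>. transpose (X \<omega>) = X \<omega>"
    and "AE \<omega> in M. opbound c (X \<omega>)"
  shows "integrable M X"
proof (rule integrable_const_bound[where B="real CARD('n) * c"])
  show "AE \<omega> in M. norm (X \<omega>) \<le> real CARD('n) * c"
    using assms(3) by eventually_elim (rule symmetric_opbound_norm_le[OF assms(2)])
qed measurable

lemma opbound_square: "opbound c A \<Longrightarrow> opbound (c * c) (A ** A)" if "c \<ge> 0"
  unfolding opbound_def matrix_vector_mul_assoc[symmetric]
  by (metis (no_types, opaque_lifting) mult.assoc mult_left_mono order_trans that)

lemma matrix_square_measurable:
  fixes X :: "'a \<Rightarrow> real^'n^'n"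
  assumes "X \<in> borel_measurable M"
  shows "(\<lambda>\<omega>. X \<omega> ** X \<omega>) \<in> borel_measurable M"
proof -
  have "(\<lambda>A :: real^'n^'n. A ** A) \<in> borel_measurable borel"
    by (intro borel_measurable_continuous_onI continuous_on_matrix_mult continuous_intros)
  from measurable_compose[OF assms this] show ?thesis .
qed

text \<open>The linear term of the scalar bound vanishes in expectation, and \<open>1 + g V \<le> exp (g V)\<close> gives the
  right-hand side the exponential form that \<open>trace_mexp_jensen\<close> requires.\<close>

lemma mgf_le_bernstein:
  fixes X :: "'a \<Rightarrow> real^'n^'n"
  assumes X [measurable]: "X \<in> borel_measurable M" and sym: "\<And>\<omega>. transpose (X \<omega>) = X \<omega>"
    and bd: "AE \<omega> in M. opbound L (X \<omega>)" and L: "L \<ge> 0"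
    and mean: "expectation X = 0"
    and \<theta>: "\<theta> \<ge> 0" "\<theta> * L < 3"
  defines "V \<equiv> expectation (\<lambda>\<omega>. X \<omega> ** X \<omega>)"
  defines "g \<equiv> \<theta>\<^sup>2 / (2 * (1 - \<theta> * L / 3))"
  shows "transpose V = V"
    and "x \<bullet> (expectation (\<lambda>\<omega>. mexp (\<theta> *\<^sub>R X \<omega>)) *v x) \<le> x \<bullet> (mexp (g *\<^sub>R V) *v x)"
proof -
  have sym2: "transpose (X \<omega> ** X \<omega>) = X \<omega> ** X \<omega>" for \<omega>
    by (simp add: matrix_transpose_mul sym)
  have X2 [measurable]: "(\<lambda>\<omega>. X \<omega> ** X \<omega>) \<in> borel_measurable M"
    by (rule matrix_square_measurable[OF X])
  have iX: "integrable M X" by (rule integrable_opbound[OF X sym bd])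
  have bd2: "AE \<omega> in M. opbound (L * L) (X \<omega> ** X \<omega>)"
    using bd by eventually_elim (rule opbound_square[OF L])
  have iX2: "integrable M (\<lambda>\<omega>. X \<omega> ** X \<omega>)"
    by (rule integrable_opbound[OF X2 sym2 bd2])
  show V: "transpose V = V"
    unfolding V_def integral_transpose[OF iX2, symmetric] sym2 ..
  have symt: "transpose (\<theta> *\<^sub>R X \<omega>) = \<theta> *\<^sub>R X \<omega>" for \<omega> by (simp add: transpose_scaleR sym)
  have bdt: "AE \<omega> in M. opbound (\<theta> * L) (\<theta> *\<^sub>R X \<omega>)"
    using bd by eventually_elim (rule opbound_scaleR[OF _ \<theta>(1)])
  have iE: "integrable M (\<lambda>\<omega>. mexp (\<theta> *\<^sub>R X \<omega>))"
    by (rule integrable_mexp[OF _ symt bdt]) measurable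
  have "x \<bullet> (expectation (\<lambda>\<omega>. mexp (\<theta> *\<^sub>R X \<omega>)) *v x)
      = expectation (\<lambda>\<omega>. mexp (\<theta> *\<^sub>R X \<omega>) \<bullet> outer x x)"
    unfolding inner_matrix_vector by (rule integral_inner_left[OF iE, symmetric])
  also have "\<dots> \<le> expectation (\<lambda>\<omega>. x \<bullet> x + \<theta> * (X \<omega> \<bullet> outer x x) + g * ((X \<omega> ** X \<omega>) \<bullet> outer x x))"
  proof (rule integral_mono_AE)
    show "AE \<omega> in M. mexp (\<theta> *\<^sub>R X \<omega>) \<bullet> outer x x
        \<le> x \<bullet> x + \<theta> * (X \<omega> \<bullet> outer x x) + g * ((X \<omega> ** X \<omega>) \<bullet> outer x x)"
      using bdt
    proof eventually_elim
      case (elim \<omega>)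
      have sq: "(\<theta> *\<^sub>R X \<omega>) ** (\<theta> *\<^sub>R X \<omega>) = \<theta>\<^sup>2 *\<^sub>R (X \<omega> ** X \<omega>)"
        by (simp add: matrix_scalar_ac scalar_matrix_assoc[symmetric] power2_eq_square)
      show ?case
        using mexp_le_bernstein[OF symt elim \<theta>(2), of x]
        unfolding inner_matrix_vector sq by (simp add: g_def)
    qed
  qed (use iE iX iX2 in auto)
  also have "\<dots> = x \<bullet> x + \<theta> * (expectation X \<bullet> outer x x) + g * (V \<bullet> outer x x)"
    using iX iX2 by (simp add: V_def prob_space)
  also have "\<dots> = x \<bullet> x + x \<bullet> ((g *\<^sub>R V) *v x)"
    by (simp add: mean inner_matrix_vector)
  also have "\<dots> \<le> x \<bullet> (mexp (g *\<^sub>R V) *v x)"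
    by (rule mexp_ge_one_plus) (simp add: transpose_scaleR V)
  finally show "x \<bullet> (expectation (\<lambda>\<omega>. mexp (\<theta> *\<^sub>R X \<omega>)) *v x) \<le> x \<bullet> (mexp (g *\<^sub>R V) *v x)" .
qed

lemma indep_vars_sum_euclidean:
  fixes X :: "'i \<Rightarrow> 'a \<Rightarrow> 'b::euclidean_space"
  assumes I: "finite I" "i \<notin> I" and indep: "indep_vars (\<lambda>_. borel) X (insert i I)"
  shows "indep_var borel (X i) borel (\<lambda>\<omega>. \<Sum>i\<in>I. X i \<omega>)"
proof -
  have "indep_var
    borel ((\<lambda>f. f i) \<circ> (\<lambda>\<omega>. restrict (\<lambda>i. X i \<omega>) {i}))
    borel ((\<lambda>f. \<Sum>i\<in>I. f i) \<circ> (\<lambda>\<omega>. restrict (\<lambda>i. X i \<omega>) I))"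
    using I by (intro indep_var_compose[OF indep_var_restrict[OF indep]]) auto
  also have "((\<lambda>f. f i) \<circ> (\<lambda>\<omega>. restrict (\<lambda>i. X i \<omega>) {i})) = X i"
    by auto
  also have "((\<lambda>f. \<Sum>i\<in>I. f i) \<circ> (\<lambda>\<omega>. restrict (\<lambda>i. X i \<omega>) I)) = (\<lambda>\<omega>. \<Sum>i\<in>I. X i \<omega>)"
    by (auto cong: rev_conj_cong)
  finally show ?thesis .
qed

lemma indep_var_nn_integral_iterated:
  assumes ind: "indep_var S X T Y" and f [measurable]: "f \<in> borel_measurable (S \<Otimes>\<^sub>M T)"
  shows "(\<integral>\<^sup>+\<omega>. f (X \<omega>, Y \<omega>) \<partial>M) = (\<integral>\<^sup>+\<omega>1. \<integral>\<^sup>+\<omega>2. f (X \<omega>1, Y \<omega>2) \<partial>M \<partial>M)"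
proof -
  have X [measurable]: "X \<in> measurable M S" and Y [measurable]: "Y \<in> measurable M T"
    using ind by (auto dest: indep_var_rv1 indep_var_rv2)
  interpret Y: prob_space "distr M T Y" by (rule prob_space_distr) fact
  have "(\<integral>\<^sup>+\<omega>. f (X \<omega>, Y \<omega>) \<partial>M) = (\<integral>\<^sup>+p. f p \<partial>distr M (S \<Otimes>\<^sub>M T) (\<lambda>\<omega>. (X \<omega>, Y \<omega>)))"
    by (subst nn_integral_distr) auto
  also have "\<dots> = (\<integral>\<^sup>+p. f p \<partial>(distr M S X \<Otimes>\<^sub>M distr M T Y))"
    using ind by (simp add: indep_var_distribution_eq)
  also have "\<dots> = (\<integral>\<^sup>+x. \<integral>\<^sup>+y. f (x, y) \<partial>distr M T Y \<partial>distr M S X)"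
    by (subst Y.nn_integral_fst[symmetric]) auto
  also have "\<dots> = (\<integral>\<^sup>+\<omega>1. \<integral>\<^sup>+\<omega>2. f (X \<omega>1, Y \<omega>2) \<partial>M \<partial>M)"
    by (subst nn_integral_distr, measurable, intro nn_integral_cong, subst nn_integral_distr) auto
  finally show ?thesis .
qed

text \<open>Induction over the summands, with \<open>H\<close> arbitrary. For a fixed value of the last summand, the
  induction hypothesis is applied with that value absorbed into \<open>H\<close>; afterwards only this summand is
  random and the Jensen inequality removes it. Nonnegative integrals are used so that Fubini requires
  no integrability.\<close>

lemma trace_mexp_sum_le:
  fixes X :: "'i \<Rightarrow> 'a \<Rightarrow> real^'n^'n"
  assumes "finite I" "indep_vars (\<lambda>_. borel) X I"
    and "\<And>i \<omega>. i \<in> I \<Longrightarrow> transpose (X i \<omega>) = X i \<omega>"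
    and "\<And>i. i \<in> I \<Longrightarrow> AE \<omega> in M. opbound c (X i \<omega>)"
    and "\<And>i. i \<in> I \<Longrightarrow> transpose (K i) = K i"
    and "\<And>i x. i \<in> I \<Longrightarrow> x \<bullet> (expectation (\<lambda>\<omega>. mexp (X i \<omega>)) *v x) \<le> x \<bullet> (mexp (K i) *v x)"
    and "transpose H = H"
  shows "(\<integral>\<^sup>+\<omega>. ennreal (trace (mexp (H + (\<Sum>i\<in>I. X i \<omega>)))) \<partial>M) \<le> ennreal (trace (mexp (H + (\<Sum>i\<in>I. K i))))"
  using assms
proof (induction I arbitrary: H rule: finite_induct)
  case empty
  then show ?case by (simp add: emeasure_space_1)
next
  case (insert k I)
  have ind: "indep_vars (\<lambda>_. borel) X I" by (rule indep_vars_subset[OF insert.prems(1)]) auto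
  have Xk [measurable]: "X k \<in> borel_measurable M"
    using insert.prems(1) by (simp add: indep_vars_def)
  have symk: "transpose (X k \<omega>) = X k \<omega>" for \<omega> by (rule insert.prems) simp
  have bdk: "AE \<omega> in M. opbound c (X k \<omega>)" by (rule insert.prems) simp
  have symK: "transpose (\<Sum>i\<in>I. K i) = (\<Sum>i\<in>I. K i)"
    unfolding transpose_sum by (intro sum.cong refl insert.prems) simp
  define H' where "H' = H + (\<Sum>i\<in>I. K i)"
  have H': "transpose H' = H'" by (simp add: H'_def transpose_add symK insert.prems)
  obtain h where h: "opbound h H'" using opbound_exists by blast
  have symH: "transpose (H' + X k \<omega>) = H' + X k \<omega>" for \<omega> by (simp add: transpose_add H' symk)
  have bdH: "AE \<omega> in M. opbound (h + c) (H' + X k \<omega>)"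
    using bdk by eventually_elim (rule opbound_add[OF h])
  define f where "f = (\<lambda>(x, y :: real^'n^'n). ennreal (trace (mexp (H + x + y))))"
  have "(\<integral>\<^sup>+\<omega>. ennreal (trace (mexp (H + (\<Sum>i\<in>insert k I. X i \<omega>)))) \<partial>M)
      = (\<integral>\<^sup>+\<omega>. f (X k \<omega>, \<Sum>i\<in>I. X i \<omega>) \<partial>M)"
    using insert.hyps by (simp add: f_def add.assoc)
  also have "\<dots> = (\<integral>\<^sup>+\<omega>1. \<integral>\<^sup>+\<omega>2. f (X k \<omega>1, \<Sum>i\<in>I. X i \<omega>2) \<partial>M \<partial>M)"
    by (rule indep_var_nn_integral_iterated[OF indep_vars_sum_euclidean[OF insert.hyps insert.prems(1)]])
      (simp add: f_def)
  also have "\<dots> \<le> (\<integral>\<^sup>+\<omega>. ennreal (trace (mexp (H' + X k \<omega>))) \<partial>M)"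
  proof (rule nn_integral_mono)
    fix \<omega>1
    have "(\<integral>\<^sup>+\<omega>2. f (X k \<omega>1, \<Sum>i\<in>I. X i \<omega>2) \<partial>M)
        \<le> ennreal (trace (mexp ((H + X k \<omega>1) + (\<Sum>i\<in>I. K i))))"
      unfolding f_def prod.case
      by (rule insert.IH[OF ind]) (simp_all add: insert.prems transpose_add symk)
    then show "(\<integral>\<^sup>+\<omega>2. f (X k \<omega>1, \<Sum>i\<in>I. X i \<omega>2) \<partial>M) \<le> ennreal (trace (mexp (H' + X k \<omega>1)))"
      by (simp add: H'_def add_ac)
  qed
  also have "\<dots> = ennreal (expectation (\<lambda>\<omega>. trace (mexp (H' + X k \<omega>))))"
  proof (rule nn_integral_eq_integral)
    have "integrable M (\<lambda>\<omega>. mexp (H' + X k \<omega>))"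
      by (rule integrable_mexp[OF _ symH bdH]) measurable
    then show "integrable M (\<lambda>\<omega>. trace (mexp (H' + X k \<omega>)))"
      unfolding trace_inner_mat_1 by simp
    show "AE \<omega> in M. 0 \<le> trace (mexp (H' + X k \<omega>))"
      using trace_mexp_pos[OF symH] by (simp add: less_imp_le)
  qed
  also have "\<dots> \<le> ennreal (trace (mexp (H' + K k)))"
    by (intro ennreal_leI trace_mexp_jensen[OF Xk symk bdk H']) (auto intro: insert.prems)
  also have "H' + K k = H + (\<Sum>i\<in>insert k I. K i)"
    using insert.hyps by (simp add: H'_def add_ac)
  finally show ?case .
qed

theorem trace_mexp_sum_bernstein:
  fixes X :: "'i \<Rightarrow> 'a \<Rightarrow> real^'n^'n"
  assumes I: "finite I" and ind: "indep_vars (\<lambda>_. borel) X I"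
    and sym: "\<And>i \<omega>. i \<in> I \<Longrightarrow> transpose (X i \<omega>) = X i \<omega>"
    and bd: "\<And>i. i \<in> I \<Longrightarrow> AE \<omega> in M. opbound L (X i \<omega>)" and L: "L \<ge> 0"
    and mean: "\<And>i. i \<in> I \<Longrightarrow> expectation (X i) = 0"
    and var: "\<And>x. (\<Sum>i\<in>I. x \<bullet> (expectation (\<lambda>\<omega>. X i \<omega> ** X i \<omega>) *v x)) \<le> v * (x \<bullet> x)"
    and \<theta>: "\<theta> \<ge> 0" "\<theta> * L < 3"
  shows "(\<integral>\<^sup>+\<omega>. ennreal (trace (mexp (\<theta> *\<^sub>R (\<Sum>i\<in>I. X i \<omega>)))) \<partial>M)
    \<le> ennreal (real CARD('n) * exp (\<theta>\<^sup>2 / (2 * (1 - \<theta> * L / 3)) * v))"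
proof -
  define g where "g = \<theta>\<^sup>2 / (2 * (1 - \<theta> * L / 3))"
  have g: "g \<ge> 0" unfolding g_def by (intro divide_nonneg_nonneg) (use \<theta> in \<open>auto simp: mult.commute\<close>)
  define K where "K i = g *\<^sub>R expectation (\<lambda>\<omega>. X i \<omega> ** X i \<omega>)" for i
  have meas: "X i \<in> borel_measurable M" if "i \<in> I" for i
    using ind that by (simp add: indep_vars_def)
  have K: "transpose (K i) = K i" if "i \<in> I" for i
    using mgf_le_bernstein(1)[OF meas sym bd L mean \<theta>, OF that that that that]
    by (simp add: K_def transpose_scaleR)
  have "(\<integral>\<^sup>+\<omega>. ennreal (trace (mexp (\<theta> *\<^sub>R (\<Sum>i\<in>I. X i \<omega>)))) \<partial>M)
     = (\<integral>\<^sup>+\<omega>. ennreal (trace (mexp (0 + (\<Sum>i\<in>I. \<theta> *\<^sub>R X i \<omega>)))) \<partial>M)"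
    by (simp add: scaleR_sum_right)
  also have "\<dots> \<le> ennreal (trace (mexp (0 + (\<Sum>i\<in>I. K i))))"
  proof (rule trace_mexp_sum_le[OF I, where c="\<theta> * L"])
    show "indep_vars (\<lambda>_. borel) (\<lambda>i \<omega>. \<theta> *\<^sub>R X i \<omega>) I"
      by (rule indep_vars_compose2[OF ind]) measurable
    show "x \<bullet> (expectation (\<lambda>\<omega>. mexp (\<theta> *\<^sub>R X i \<omega>)) *v x) \<le> x \<bullet> (mexp (K i) *v x)" if "i \<in> I" for i x
      unfolding K_def g_def
      by (rule mgf_le_bernstein(2)[OF meas sym bd L mean \<theta>, OF that that that that])
    show "AE \<omega> in M. opbound (\<theta> * L) (\<theta> *\<^sub>R X i \<omega>)" if "i \<in> I" for i
      using bd[OF that] by eventually_elim (rule opbound_scaleR[OF _ \<theta>(1)])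
  qed (auto simp: transpose_scaleR sym K linear_0[OF linear_transpose])
  also have "trace (mexp (0 + (\<Sum>i\<in>I. K i))) \<le> real CARD('n) * exp (g * v)"
  proof (rule trace_mexp_le)
    show "transpose (0 + (\<Sum>i\<in>I. K i)) = 0 + (\<Sum>i\<in>I. K i)" by (simp add: transpose_sum K)
    show "x \<bullet> ((0 + (\<Sum>i\<in>I. K i)) *v x) \<le> g * v * (x \<bullet> x)" for x
      using mult_left_mono[OF var[of x] g]
      by (simp add: K_def sum_matrix_vector_mult inner_sum_right scaleR_matrix_vector_assoc[symmetric]
          sum_distrib_left mult_ac)
  qed
  finally show ?thesis by (simp add: g_def ennreal_leI)
qed

end

section \<open>The spectral norm of a complex matrix\<close>

lemma conj_transpose_adjoint:
  fixes A :: "complex^'n^'m"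
  shows "(A *v y) \<bullet> x = y \<bullet> (conj_transpose A *v x)"
proof -
  have ip: "a \<bullet> b = Re (a * cnj b)" for a b :: complex by (simp add: inner_complex_def)
  have "(A *v y) \<bullet> x = (\<Sum>i\<in>UNIV. \<Sum>j\<in>UNIV. Re (A$i$j * y$j * cnj (x$i)))"
    by (simp add: inner_vec_def ip matrix_vector_mult_def sum_distrib_right)
  also have "\<dots> = (\<Sum>j\<in>UNIV. \<Sum>i\<in>UNIV. Re (y$j * cnj (cnj (A$i$j) * x$i)))"
    by (subst sum.swap) (simp add: mult_ac)
  also have "\<dots> = y \<bullet> (conj_transpose A *v x)"
    by (simp only: inner_vec_def ip matrix_vector_mult_def conj_transpose_def vec_lambda_beta
        cnj_sum sum_distrib_left Re_sum)
  finally show ?thesis .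
qed

lemma conj_transpose_invol [simp]: "conj_transpose (conj_transpose A) = A"
  by (simp add: conj_transpose_def vec_eq_iff)

lemma linear_conj_transpose: "linear (conj_transpose :: complex^'n^'m \<Rightarrow> complex^'m^'n)"
  by (rule linearI) (simp_all add: conj_transpose_def vec_eq_iff)

lemma of_real_scalar_mult: "complex_of_real r *s x = r *\<^sub>R x"
  unfolding vec_eq_iff by (simp add: scaleR_conv_of_real[where 'a=complex])

lemma linear_complex_matrix_vector: "linear (\<lambda>x. (A :: complex^'n^'m) *v x)"
  by (rule linearI)
    (simp_all add: matrix_vector_right_distrib of_real_scalar_mult[symmetric] vector_scalar_commute)

lemma linear_complex_matrix_vector_left: "linear (\<lambda>A :: complex^'n^'m. A *v x)"
  by (rule linearI)
    (simp_all add: vec_eq_iff matrix_vector_mult_def scaleR_sum_right distrib_right sum.distrib)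

lemma card_bool_prod: "CARD(bool \<times> 'n::finite) = DIM(complex^'n)"
  by simp

text \<open>The operator \<open>A\<^sup>* A\<close> on \<open>complex^'n\<close> is self-adjoint for the real inner product, so the real spectral
  theorem applies to it, with twice as many real eigenvectors as complex dimensions.\<close>

lemma singular_values_eigenbasis:
  fixes A :: "complex^'n^'m"
  obtains u :: "bool \<times> 'n \<Rightarrow> complex^'n" and a where
    "orthonormal u" "\<And>i. conj_transpose A *v (A *v u i) = a i *\<^sub>R u i" "\<And>i. a i \<ge> 0"
    "singular_values A = (\<lambda>i. sqrt (a i)) ` UNIV"
proof -
  define f where "f y = conj_transpose A *v (A *v y)" for y
  have lin: "linear f"
    unfolding f_def using linear_compose[OF linear_complex_matrix_vector linear_complex_matrix_vector]
    by (simp add: o_def)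
  have adj: "f x \<bullet> y = (A *v x) \<bullet> (A *v y)" for x y
    by (simp add: f_def conj_transpose_adjoint)
  have sa: "f x \<bullet> y = x \<bullet> f y" for x y
    by (metis adj inner_commute)
  obtain u :: "bool \<times> 'n \<Rightarrow> complex^'n" and a where u: "orthonormal u" and fu: "\<And>i. f (u i) = a i *\<^sub>R u i"
    using selfadjoint_spectral_theorem[OF lin sa card_bool_prod] by blast
  have uu: "u i \<bullet> u i = 1" for i using orthonormalD[OF u] by simp
  have a: "a i \<ge> 0" for i
    using adj[of "u i" "u i"] by (simp add: fu uu)
  have "singular_values A \<subseteq> (\<lambda>i. sqrt (a i)) ` UNIV"
  proof
    fix s assume "s \<in> singular_values A"
    then obtain x where s: "s \<ge> 0" and x: "x \<noteq> 0" "f x = s\<^sup>2 *\<^sub>R x"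
      by (auto simp: singular_values_def eigenvalue_def f_def of_real_scalar_mult
          matrix_vector_mul_assoc simp del: of_real_power)
    have "\<exists>i. x \<bullet> u i \<noteq> 0"
    proof (rule ccontr)
      assume "\<nexists>i. x \<bullet> u i \<noteq> 0"
      then have "x \<bullet> u i = 0" for i by blast
      then have "x = 0" by (subst orthonormal_expand[OF u card_bool_prod, of x]) simp
      then show False using x by simp
    qed
    then obtain i where i: "x \<bullet> u i \<noteq> 0" by blast
    have "s\<^sup>2 * (x \<bullet> u i) = a i * (x \<bullet> u i)"
      using sa[of x "u i"] by (simp add: x fu)
    then have "a i = s\<^sup>2" using i by simp
    then show "s \<in> (\<lambda>i. sqrt (a i)) ` UNIV" using s by (intro image_eqI[of _ _ i]) simp_all
  qed
  moreover have "sqrt (a i) \<in> singular_values A" for i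
  proof -
    have "u i \<noteq> 0" using uu[of i] by auto
    moreover have "(conj_transpose A ** A) *v u i = complex_of_real ((sqrt (a i))\<^sup>2) *s u i"
      using fu[of i] a[of i] unfolding of_real_scalar_mult
      by (simp add: f_def matrix_vector_mul_assoc)
    ultimately show ?thesis
      using a[of i] unfolding singular_values_def eigenvalue_def by (auto simp del: of_real_power)
  qed
  ultimately have "singular_values A = (\<lambda>i. sqrt (a i)) ` UNIV"
    by (intro equalityI image_subsetI)
  then show ?thesis by (rule that[OF u fu[unfolded f_def] a])
qed

text \<open>The three properties by which the largest singular value is handled from here on: it bounds the
  operator, and it is attained at an eigenvector of \<open>A\<^sup>* A\<close>.\<close>

lemma spectral_norm_nonneg: "0 \<le> spectral_norm (A :: complex^'n^'m)"
  and spectral_norm_mult: "norm (A *v y) \<le> spectral_norm A * norm y"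
  and spectral_norm_attained:
    "\<exists>y. y \<noteq> 0 \<and> conj_transpose A *v (A *v y) = (spectral_norm A)\<^sup>2 *\<^sub>R y"
proof -
  obtain u :: "bool \<times> 'n \<Rightarrow> complex^'n" and a where u: "orthonormal u"
    and fu: "\<And>i. conj_transpose A *v (A *v u i) = a i *\<^sub>R u i" and a: "\<And>i. a i \<ge> 0"
    and sv: "singular_values A = (\<lambda>i. sqrt (a i)) ` UNIV"
    by (rule singular_values_eigenbasis[of A]) (rule that)
  have "spectral_norm A \<in> (\<lambda>i. sqrt (a i)) ` UNIV"
    unfolding spectral_norm_def sv by (rule Max_in) auto
  then obtain i where i: "spectral_norm A = sqrt (a i)" by blast
  show s0: "0 \<le> spectral_norm A" using a by (simp add: i)
  have "u i \<noteq> 0" using orthonormalD[OF u, of i i] by auto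
  then show "\<exists>y. y \<noteq> 0 \<and> conj_transpose A *v (A *v y) = (spectral_norm A)\<^sup>2 *\<^sub>R y"
    using fu[of i] a[of i] by (intro exI[of _ "u i"]) (simp add: i)
  have le: "a j \<le> (spectral_norm A)\<^sup>2" for j
  proof -
    have "sqrt (a j) \<le> spectral_norm A" unfolding spectral_norm_def sv by (rule Max_ge) auto
    then show ?thesis using a[of j] real_le_lsqrt sqrt_le_D by blast
  qed
  have "(norm (A *v y))\<^sup>2 = y \<bullet> (conj_transpose A *v (A *v y))"
    by (simp add: conj_transpose_adjoint[symmetric] dot_square_norm)
  also have "\<dots> = (\<Sum>j\<in>UNIV. a j * (u j \<bullet> y)\<^sup>2)"
  proof -
    have "u j \<bullet> (conj_transpose A *v (A *v y)) = a j * (u j \<bullet> y)" for j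
      by (metis conj_transpose_adjoint fu inner_commute inner_scaleR_left)
    then show ?thesis
      by (subst orthonormal_inner[OF u card_bool_prod]) (simp add: power2_eq_square mult_ac)
  qed
  also have "\<dots> \<le> (\<Sum>j\<in>UNIV. (spectral_norm A)\<^sup>2 * (u j \<bullet> y)\<^sup>2)"
    by (intro sum_mono mult_right_mono le) auto
  also have "\<dots> = (spectral_norm A * norm y)\<^sup>2"
    using orthonormal_inner[OF u card_bool_prod, of y y]
    by (simp add: sum_distrib_left[symmetric] power_mult_distrib dot_square_norm power2_eq_square)
  finally show "norm (A *v y) \<le> spectral_norm A * norm y"
    by (rule power2_le_imp_le) (simp add: s0)
qed

lemma spectral_norm_le:
  assumes "\<And>y. norm (A *v y) \<le> c * norm y"
  shows "spectral_norm A \<le> c"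
proof -
  obtain y where y: "y \<noteq> 0" "conj_transpose A *v (A *v y) = (spectral_norm A)\<^sup>2 *\<^sub>R y"
    using spectral_norm_attained by blast
  have "(norm (A *v y))\<^sup>2 = (spectral_norm A * norm y)\<^sup>2"
    using y(2) conj_transpose_adjoint[of A y "A *v y"]
    by (simp add: dot_square_norm power_mult_distrib)
  then have "spectral_norm A * norm y = norm (A *v y)"
    by (simp add: spectral_norm_nonneg)
  then have "spectral_norm A * norm y \<le> c * norm y" using assms[of y] by simp
  then show ?thesis using y(1) mult_right_le_imp_le[of "spectral_norm A" "norm y" c] by simp
qed

lemma spectral_norm_conj_transpose_mult:
  "norm (conj_transpose A *v x) \<le> spectral_norm A * norm x"
proof -
  let ?w = "conj_transpose A *v x"
  have "norm ?w * norm ?w = (A *v ?w) \<bullet> x"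
    by (simp add: conj_transpose_adjoint power2_norm_eq_inner[symmetric] power2_eq_square)
  also have "\<dots> \<le> norm (A *v ?w) * norm x" by (rule norm_cauchy_schwarz)
  also have "\<dots> \<le> (spectral_norm A * norm ?w) * norm x"
    by (intro mult_right_mono spectral_norm_mult) simp
  finally have "norm ?w * norm ?w \<le> norm ?w * (spectral_norm A * norm x)" by (simp add: mult_ac)
  then show ?thesis
    by (cases "norm ?w = 0") (simp_all add: spectral_norm_nonneg)
qed

lemma spectral_norm_mult_le:
  "spectral_norm (A ** B) \<le> spectral_norm A * spectral_norm B"
proof (rule spectral_norm_le)
  fix y
  have "norm ((A ** B) *v y) \<le> spectral_norm A * norm (B *v y)"
    unfolding matrix_vector_mul_assoc[symmetric] by (rule spectral_norm_mult)
  also have "\<dots> \<le> spectral_norm A * (spectral_norm B * norm y)"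
    by (intro mult_left_mono spectral_norm_mult spectral_norm_nonneg)
  finally show "norm ((A ** B) *v y) \<le> spectral_norm A * spectral_norm B * norm y" by (simp add: mult_ac)
qed

lemma spectral_norm_conj_transpose: "spectral_norm (conj_transpose A) = spectral_norm A"
  by (metis antisym conj_transpose_invol spectral_norm_conj_transpose_mult spectral_norm_le)

lemma norm_vec_le_sum: "norm x \<le> (\<Sum>i\<in>UNIV. norm (x $ i))"
  unfolding norm_vec_def by (rule L2_set_le_sum) simp

lemma entry_le_spectral_norm:
  fixes A :: "complex^'n^'m"
  shows "norm (A $ i $ j) \<le> spectral_norm A"
proof -
  have "A $ i $ j = (A *v axis j 1) $ i"
    by (simp add: matrix_vector_mult_def axis_def if_distrib[where f="\<lambda>x. _ * x"] cong: if_cong)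
  then have "norm (A $ i $ j) = norm ((A *v axis j 1) $ i)" by (rule arg_cong)
  also have "\<dots> \<le> norm (A *v axis j 1)" by (rule Finite_Cartesian_Product.norm_nth_le)
  also have "\<dots> \<le> spectral_norm A" using spectral_norm_mult[of A "axis j 1"] by (simp add: norm_axis_1)
  finally show ?thesis .
qed

lemma norm_le_spectral_norm:
  fixes A :: "complex^'n^'m"
  shows "norm A \<le> real CARD('m) * real CARD('n) * spectral_norm A"
proof -
  have "norm A \<le> (\<Sum>i\<in>UNIV. \<Sum>j\<in>UNIV. norm (A $ i $ j))"
    by (intro order_trans[OF norm_vec_le_sum] sum_mono norm_vec_le_sum)
  also have "\<dots> \<le> (\<Sum>i\<in>(UNIV::'m set). \<Sum>j\<in>(UNIV::'n set). spectral_norm A)"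
    by (intro sum_mono entry_le_spectral_norm)
  finally show ?thesis by (simp add: mult_ac)
qed

lemma norm_complex_matrix_vector_le: "norm ((A :: complex^'n^'m) *v y) \<le> norm A * norm y"
proof -
  have "norm ((A *v y) $ i) \<le> norm (A $ i) * norm y" for i
  proof -
    have "norm ((A *v y) $ i) \<le> (\<Sum>j\<in>UNIV. \<bar>norm (A$i$j)\<bar> * \<bar>norm (y$j)\<bar>)"
      unfolding matrix_vector_mult_def by (simp add: norm_mult[symmetric] norm_sum)
    also have "\<dots> \<le> norm (A $ i) * norm y"
      unfolding norm_vec_def[of "A$i"] norm_vec_def[of y] by (rule L2_set_mult_ineq)
    finally show ?thesis .
  qed
  then have "norm (A *v y) \<le> L2_set (\<lambda>i. norm (A $ i) * norm y) UNIV"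
    unfolding norm_vec_def[of "A *v y"] by (intro L2_set_mono) auto
  also have "\<dots> = norm A * norm y"
    by (simp add: L2_set_left_distrib norm_vec_def[of A])
  finally show ?thesis .
qed

text \<open>The triangle inequality makes the spectral norm Lipschitz for the entrywise Euclidean norm.\<close>

lemma continuous_spectral_norm: "continuous_on UNIV (spectral_norm :: complex^'n^'m \<Rightarrow> real)"
proof -
  have le: "spectral_norm A \<le> spectral_norm B + norm (A - B)" for A B :: "complex^'n^'m"
  proof (rule spectral_norm_le)
    fix y
    have "A *v y = B *v y + (A - B) *v y" by (simp add: matrix_vector_mult_add_rdistrib[symmetric])
    then have "norm (A *v y) \<le> norm (B *v y) + norm ((A - B) *v y)" by (metis norm_triangle_ineq)
    also have "\<dots> \<le> spectral_norm B * norm y + norm (A - B) * norm y"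
      by (intro add_mono spectral_norm_mult norm_complex_matrix_vector_le)
    finally show "norm (A *v y) \<le> (spectral_norm B + norm (A - B)) * norm y" by (simp add: distrib_right)
  qed
  have "1-lipschitz_on UNIV (spectral_norm :: complex^'n^'m \<Rightarrow> real)"
  proof (rule lipschitz_onI)
    fix A B :: "complex^'n^'m"
    show "dist (spectral_norm A) (spectral_norm B) \<le> 1 * dist A B"
      using le[of A B] le[of B A] by (simp add: dist_norm norm_minus_commute abs_le_iff)
  qed simp
  then show ?thesis by (rule lipschitz_on_continuous_on)
qed

lemma spectral_norm_measurable [measurable]:
  "spectral_norm \<in> borel_measurable (borel :: (complex^'n^'m) measure)"
  by (rule borel_measurable_continuous_onI[OF continuous_spectral_norm])

section \<open>The self-adjoint dilation as a real symmetric matrix\<close>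

text \<open>The Hermitian dilation, acting on pairs, with the real inner product of the product space. Its
  matrix is taken in an orthonormal basis whose choice is immaterial; an index type of the right
  cardinality \<open>2 (d\<^sub>1 + d\<^sub>2)\<close> is \<open>bool \<times> ('d1 + 'd2)\<close>.\<close>

definition dilation_map ::
  "complex^'d2^'d1 \<Rightarrow> (complex^'d1) \<times> (complex^'d2) \<Rightarrow> (complex^'d1) \<times> (complex^'d2)" where
  "dilation_map A z = (A *v snd z, conj_transpose A *v fst z)"

definition dilation_frame ::
  "bool \<times> ('d1::finite + 'd2::finite) \<Rightarrow> (complex^'d1) \<times> (complex^'d2)" where
  "dilation_frame = (SOME u. orthonormal u)"

definition dilation_coords ::
  "(complex^'d1) \<times> (complex^'d2) \<Rightarrow> real^(bool \<times> ('d1 + 'd2))" where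
  "dilation_coords z = (\<chi> i. dilation_frame i \<bullet> z)"

definition dilation :: "complex^'d2^'d1 \<Rightarrow> real^(bool \<times> ('d1 + 'd2))^(bool \<times> ('d1 + 'd2))" where
  "dilation A = (\<chi> i j. dilation_frame i \<bullet> dilation_map A (dilation_frame j))"

lemma card_dilation_frame:
  "CARD(bool \<times> ('d1::finite + 'd2::finite)) = DIM((complex^'d1) \<times> (complex^'d2))"
  by (simp add: card_UNIV_sum)

text \<open>Such a basis exists: any eigenbasis of the identity will do.\<close>

lemma orthonormal_dilation_frame:
  "orthonormal (dilation_frame :: bool \<times> ('d1 + 'd2) \<Rightarrow> (complex^'d1) \<times> (complex^'d2))"
proof -
  have "\<exists>u :: bool \<times> ('d1 + 'd2) \<Rightarrow> (complex^'d1) \<times> (complex^'d2). orthonormal u"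
    using selfadjoint_spectral_theorem[OF linear_ident refl card_dilation_frame] by blast
  then show ?thesis unfolding dilation_frame_def by (rule someI_ex)
qed

lemmas dilation_frame_expand = orthonormal_expand[OF orthonormal_dilation_frame card_dilation_frame]

lemma dilation_coords_inner: "dilation_coords x \<bullet> dilation_coords y = x \<bullet> y"
  by (subst orthonormal_inner[OF orthonormal_dilation_frame card_dilation_frame, of x y])
    (simp add: inner_vec_def dilation_coords_def)

lemma dilation_coords_norm: "norm (dilation_coords x) = norm x"
  by (simp add: norm_eq_sqrt_inner dilation_coords_inner)

lemma dilation_coords_surj: "\<exists>x. dilation_coords x = z"
proof
  show "dilation_coords (\<Sum>i\<in>UNIV. z $ i *\<^sub>R dilation_frame i) = z"
    by (simp add: dilation_coords_def vec_eq_iff inner_sum_right orthonormalD[OF orthonormal_dilation_frame]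
        if_distrib[where f="\<lambda>x. _ * x"] cong: if_cong)
qed

lemma dilation_coords_scaleR: "dilation_coords (c *\<^sub>R x) = c *\<^sub>R dilation_coords x"
  by (simp add: dilation_coords_def vec_eq_iff)

lemma linear_dilation_map: "linear (dilation_map A)"
  by (rule linearI)
    (simp_all add: dilation_map_def linear_add[OF linear_complex_matrix_vector]
      linear_cmul[OF linear_complex_matrix_vector])

lemma linear_dilation_map_left: "linear (\<lambda>A. dilation_map A z)"
  by (rule linearI)
    (simp_all add: dilation_map_def linear_add[OF linear_conj_transpose] linear_cmul[OF linear_conj_transpose]
      linear_add[OF linear_complex_matrix_vector_left] linear_cmul[OF linear_complex_matrix_vector_left])

lemma dilation_map_selfadjoint: "dilation_map A x \<bullet> y = x \<bullet> dilation_map A y"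
  using conj_transpose_adjoint[of A "snd x" "fst y"] conj_transpose_adjoint[of A "snd y" "fst x"]
  by (simp add: dilation_map_def inner_prod_def inner_commute)

lemma dilation_mult_coords: "dilation A *v dilation_coords x = dilation_coords (dilation_map A x)"
proof -
  have "dilation_map A x = (\<Sum>j\<in>UNIV. (x \<bullet> dilation_frame j) *\<^sub>R dilation_map A (dilation_frame j))"
    by (subst dilation_frame_expand[of x])
      (simp only: linear_sum[OF linear_dilation_map] linear_cmul[OF linear_dilation_map])
  then show ?thesis
    by (simp add: vec_eq_iff matrix_vector_mult_def dilation_def dilation_coords_def inner_sum_right
        inner_commute[of _ x] mult_ac)
qed

lemma transpose_dilation: "transpose (dilation A) = dilation A"
proof -
  have "x \<bullet> dilation_map A y = y \<bullet> dilation_map A x" for x y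
    by (metis dilation_map_selfadjoint inner_commute)
  then show ?thesis by (simp add: transpose_def dilation_def vec_eq_iff)
qed

lemma linear_dilation: "linear dilation"
  by (rule linearI)
    (simp_all add: dilation_def vec_eq_iff linear_add[OF linear_dilation_map_left]
      linear_cmul[OF linear_dilation_map_left] inner_add_right)

lemma dilation_measurable [measurable]: "dilation \<in> borel_measurable borel"
  by (intro borel_measurable_continuous_onI linear_continuous_on
      linear_conv_bounded_linear[THEN iffD1] linear_dilation)

lemma dilation_map_norm:
  "(norm (dilation_map A (x, y)))\<^sup>2 = (norm (A *v y))\<^sup>2 + (norm (conj_transpose A *v x))\<^sup>2"
  by (simp add: dilation_map_def norm_Pair)

lemma opbound_dilation: "opbound (spectral_norm A) (dilation (A :: complex^'d2^'d1))"
  unfolding opbound_def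
proof
  fix z :: "real^(bool \<times> ('d1 + 'd2))"
  obtain w where w: "dilation_coords w = z" using dilation_coords_surj by blast
  obtain x y where xy: "w = (x, y)" by (cases w)
  have "(norm (dilation_map A w))\<^sup>2 \<le> (spectral_norm A * norm y)\<^sup>2 + (spectral_norm A * norm x)\<^sup>2"
    unfolding xy dilation_map_norm
    by (intro add_mono power_mono spectral_norm_mult spectral_norm_conj_transpose_mult) auto
  also have "\<dots> = (spectral_norm A * norm w)\<^sup>2"
    by (simp add: xy norm_Pair power_mult_distrib algebra_simps)
  finally have "norm (dilation_map A w) \<le> spectral_norm A * norm w"
    by (rule power2_le_imp_le) (simp add: spectral_norm_nonneg)
  then show "norm (dilation A *v z) \<le> spectral_norm A * norm z"
    by (simp add: w[symmetric] dilation_mult_coords dilation_coords_norm)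
qed

text \<open>The block diagonal square of the dilation is what makes both \<open>A A\<^sup>*\<close> and \<open>A\<^sup>* A\<close> appear in the variance.\<close>

lemma dilation_square_quadratic:
  "dilation_coords (x, y) \<bullet> ((dilation A ** dilation A) *v dilation_coords (x, y))
    = y \<bullet> ((conj_transpose A ** A) *v y) + x \<bullet> ((A ** conj_transpose A) *v x)"
  by (simp add: matrix_vector_mul_assoc[symmetric] dilation_mult_coords dilation_coords_inner
      dilation_map_def inner_prod_def)

text \<open>Bessel's inequality for two vectors.\<close>

lemma two_orthonormal_le:
  fixes z1 z2 u :: "'a::real_inner"
  assumes "norm z1 = 1" "norm z2 = 1" "z1 \<bullet> z2 = 0" "norm u = 1"
  shows "(z1 \<bullet> u)\<^sup>2 + (z2 \<bullet> u)\<^sup>2 \<le> 1"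
proof -
  define w where "w = u - (z1 \<bullet> u) *\<^sub>R z1 - (z2 \<bullet> u) *\<^sub>R z2"
  have "z1 \<bullet> z1 = 1" "z2 \<bullet> z2 = 1" "u \<bullet> u = 1" "z2 \<bullet> z1 = 0"
    using assms by (simp_all add: norm_eq_1 inner_commute)
  then have "w \<bullet> w = 1 - (z1 \<bullet> u)\<^sup>2 - (z2 \<bullet> u)\<^sup>2"
    using assms(3) by (simp add: w_def inner_diff_left inner_diff_right inner_commute[of u z1] inner_commute[of u z2] power2_eq_square)
  then show ?thesis using inner_ge_zero[of w] by linarith
qed

lemma eigenvector_mexp_quadratic:
  assumes A: "transpose A = A" and z: "A *v z = s *\<^sub>R z"
  shows "z \<bullet> (mexp A *v z) = exp s * (z \<bullet> z)"
proof -
  obtain u a where ua: "eigensystem A u a" using symmetric_eigensystem[OF A] .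
  have "exp (a i) * (z \<bullet> u i)\<^sup>2 = exp s * (z \<bullet> u i)\<^sup>2" for i
  proof (cases "z \<bullet> u i = 0")
    case False
    have "s * (z \<bullet> u i) = a i * (z \<bullet> u i)"
      using symmetric_inner[OF A, of z "u i"] by (simp add: z eigensystem_eq[OF ua])
    then show ?thesis using False by simp
  qed simp
  then have "(\<Sum>i\<in>UNIV. exp (a i) * (z \<bullet> u i)\<^sup>2) = (\<Sum>i\<in>UNIV. exp s * (z \<bullet> u i)\<^sup>2)"
    by (intro sum.cong refl)
  then show ?thesis
    by (simp add: eigensystem_quadratic[OF eigensystem_mexp[OF ua]] sum_distrib_left[symmetric]
        orthonormal_sum_squares[OF eigensystem_orthonormal[OF ua]])
qed

lemma trace_mexp_ge_double_eigenvalue: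
  assumes A: "transpose A = A"
    and z: "A *v z1 = s *\<^sub>R z1" "A *v z2 = s *\<^sub>R z2" "norm z1 = 1" "norm z2 = 1" "z1 \<bullet> z2 = 0"
  shows "2 * exp s \<le> trace (mexp A)"
proof -
  obtain u a where ua: "eigensystem A u a" using symmetric_eigensystem[OF A] .
  have "2 * exp s = z1 \<bullet> (mexp A *v z1) + z2 \<bullet> (mexp A *v z2)"
    using z(3,4) by (simp add: eigenvector_mexp_quadratic[OF A z(1)] eigenvector_mexp_quadratic[OF A z(2)] norm_eq_1)
  also have "\<dots> = (\<Sum>i\<in>UNIV. exp (a i) * ((z1 \<bullet> u i)\<^sup>2 + (z2 \<bullet> u i)\<^sup>2))"
    by (simp add: eigensystem_quadratic[OF eigensystem_mexp[OF ua]] sum.distrib distrib_left)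
  also have "\<dots> \<le> (\<Sum>i\<in>UNIV. exp (a i) * 1)"
    by (intro sum_mono mult_left_mono two_orthonormal_le z orthonormal_norm[OF eigensystem_orthonormal[OF ua]]) simp
  finally show ?thesis by (simp add: eigensystem_trace[OF eigensystem_mexp[OF ua]])
qed

lemma imaginary_multiple_orthogonal: "x \<bullet> (\<i> *s x) = 0" for x :: "complex^'n"
  by (simp add: inner_vec_def inner_complex_def)

lemma imaginary_multiple_norm: "norm (\<i> *s x) = norm x" for x :: "complex^'n"
  by (simp add: norm_vec_def norm_mult)

text \<open>A right singular vector \<open>y\<close> for the singular value \<open>s > 0\<close> gives the eigenvector \<open>(A y, s y)\<close> of the
  dilation with eigenvalue \<open>s\<close>, and \<open>\<i>\<close> times it is a second one, orthogonal to it in the real inner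
  product. For \<open>s = 0\<close> the dilation is zero and the trace is the full dimension.\<close>

lemma trace_mexp_dilation_ge:
  assumes \<theta>: "\<theta> \<ge> 0"
  shows "2 * exp (\<theta> * spectral_norm A) \<le> trace (mexp (\<theta> *\<^sub>R dilation (A :: complex^'d2^'d1)))"
proof (cases "spectral_norm A = 0")
  case True
  obtain u a where ua: "eigensystem (\<theta> *\<^sub>R dilation A) u a"
    using symmetric_eigensystem[of "\<theta> *\<^sub>R dilation A"] by (auto simp: transpose_scaleR transpose_dilation)
  have "opbound 0 (\<theta> *\<^sub>R dilation A)"
    using opbound_scaleR[OF opbound_dilation \<theta>, of A] by (simp add: True)
  then have "a i = 0" for i using eigensystem_opbound[OF ua, of 0 i] by simp
  then have "trace (mexp (\<theta> *\<^sub>R dilation A)) = 2 * (real CARD('d1) + real CARD('d2))"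
    by (simp add: eigensystem_trace[OF eigensystem_mexp[OF ua]] card_UNIV_sum)
  moreover have "real CARD('d1) \<ge> 1" by (simp add: Suc_leI)
  ultimately show ?thesis by (simp add: True add_increasing2)
next
  case False
  define s where "s = spectral_norm A"
  have s: "s > 0" using False spectral_norm_nonneg[of A] by (simp add: s_def)
  obtain y where y: "y \<noteq> 0" "conj_transpose A *v (A *v y) = s\<^sup>2 *\<^sub>R y"
    using spectral_norm_attained[of A] unfolding s_def by blast
  have iA: "B *v (\<i> *s w) = \<i> *s (B *v w)" for B :: "complex^'m^'k" and w
    by (simp add: vector_scalar_commute)
  define w1 where "w1 = (A *v y, s *\<^sub>R y)"
  define w2 where "w2 = (\<i> *s (A *v y), \<i> *s (s *\<^sub>R y))"
  have A1: "dilation_map A w1 = s *\<^sub>R w1"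
    by (simp add: dilation_map_def w1_def y linear_cmul[OF linear_complex_matrix_vector] power2_eq_square)
  have A2: "dilation_map A w2 = s *\<^sub>R w2"
    by (simp add: dilation_map_def w2_def y iA linear_cmul[OF linear_complex_matrix_vector]
        power2_eq_square vec_eq_iff scaleR_conv_of_real[where 'a=complex])
  have n: "norm w2 = norm w1" by (simp add: w1_def w2_def norm_Pair imaginary_multiple_norm)
  have w1: "norm w1 \<noteq> 0" using y s by (simp add: w1_def prod_eq_iff)
  have orth: "w1 \<bullet> w2 = 0" by (simp add: w1_def w2_def inner_prod_def imaginary_multiple_orthogonal)
  define c where "c = inverse (norm w1)"
  have eig: "(\<theta> *\<^sub>R dilation A) *v dilation_coords (c *\<^sub>R w) = (\<theta> * s) *\<^sub>R dilation_coords (c *\<^sub>R w)"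
    if "dilation_map A w = s *\<^sub>R w" for w
    unfolding scaleR_matrix_vector_assoc[symmetric] dilation_mult_coords
      linear_cmul[OF linear_dilation_map] that
    by (simp add: dilation_coords_scaleR mult_ac)
  have "2 * exp (\<theta> * s) \<le> trace (mexp (\<theta> *\<^sub>R dilation A))"
  proof (rule trace_mexp_ge_double_eigenvalue[OF _ eig[OF A1] eig[OF A2]])
    show "transpose (\<theta> *\<^sub>R dilation A) = \<theta> *\<^sub>R dilation A" by (simp add: transpose_scaleR transpose_dilation)
    show "norm (dilation_coords (c *\<^sub>R w1)) = 1" "norm (dilation_coords (c *\<^sub>R w2)) = 1"
      using w1 by (simp_all add: dilation_coords_norm n c_def)
    show "dilation_coords (c *\<^sub>R w1) \<bullet> dilation_coords (c *\<^sub>R w2) = 0"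
      by (simp add: dilation_coords_inner orth)
  qed
  then show ?thesis by (simp add: s_def)
qed

section \<open>Second moments of independent random matrices\<close>

lemma matrix_expectation_eq_integral:
  assumes X: "integrable M X"
  shows "matrix_expectation M X = integral\<^sup>L M X"
proof -
  have "integral\<^sup>L M (\<lambda>\<omega>. X \<omega> $ i $ j) = integral\<^sup>L M X $ i $ j" for i j
    by (rule integral_bounded_linear[OF _ X])
      (intro bounded_linear_compose[OF bounded_linear_vec_nth bounded_linear_vec_nth])
  then show ?thesis by (simp add: matrix_expectation_def vec_eq_iff)
qed

lemma conj_transpose_measurable [measurable]: "conj_transpose \<in> borel_measurable borel"
  by (intro borel_measurable_continuous_onI linear_continuous_on
      linear_conv_bounded_linear[THEN iffD1] linear_conj_transpose)

lemma matrix_conj_transpose_measurable [measurable]: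
  "(\<lambda>A :: complex^'n^'m. A ** conj_transpose A) \<in> borel_measurable borel"
proof -
  have "continuous_on UNIV (\<lambda>A :: complex^'n^'m. A ** conj_transpose A)"
    unfolding matrix_matrix_mult_def conj_transpose_def by (simp, intro continuous_intros)
  then show ?thesis by (rule borel_measurable_continuous_onI)
qed

lemma entry_measurable: "(\<lambda>A :: complex^'n^'m. A $ i $ j) \<in> borel_measurable borel"
  by (intro borel_measurable_continuous_onI continuous_intros)

lemma conj_transpose_sum: "conj_transpose (sum A I) = (\<Sum>i\<in>I. conj_transpose (A i))"
  by (rule linear_sum[OF linear_conj_transpose])

context prob_space
begin

lemma integrable_spectral_norm_bounded:
  fixes X :: "'a \<Rightarrow> complex^'n^'m"
  assumes [measurable]: "X \<in> borel_measurable M" and bd: "AE \<omega> in M. spectral_norm (X \<omega>) \<le> L"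
  shows "integrable M X"
proof (rule integrable_const_bound[where B="real CARD('m) * real CARD('n) * L"])
  show "AE \<omega> in M. norm (X \<omega>) \<le> real CARD('m) * real CARD('n) * L"
    using bd
  proof eventually_elim
    case (elim \<omega>)
    have "norm (X \<omega>) \<le> real CARD('m) * real CARD('n) * spectral_norm (X \<omega>)"
      by (rule norm_le_spectral_norm)
    also have "\<dots> \<le> real CARD('m) * real CARD('n) * L" by (intro mult_left_mono elim) simp
    finally show ?case .
  qed
qed measurable

lemma integrable_gram:
  fixes X :: "'a \<Rightarrow> complex^'n^'m"
  assumes X [measurable]: "X \<in> borel_measurable M" and bd: "AE \<omega> in M. spectral_norm (X \<omega>) \<le> L"
  shows "integrable M (\<lambda>\<omega>. X \<omega> ** conj_transpose (X \<omega>))"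
proof (rule integrable_spectral_norm_bounded)
  show "AE \<omega> in M. spectral_norm (X \<omega> ** conj_transpose (X \<omega>)) \<le> L * L"
    using bd
  proof eventually_elim
    case (elim \<omega>)
    have "spectral_norm (X \<omega> ** conj_transpose (X \<omega>)) \<le> spectral_norm (X \<omega>) * spectral_norm (X \<omega>)"
      using spectral_norm_mult_le[of "X \<omega>" "conj_transpose (X \<omega>)"] by (simp add: spectral_norm_conj_transpose)
    also have "\<dots> \<le> L * L"
      using elim spectral_norm_nonneg[of "X \<omega>"] by (intro mult_mono) auto
    finally show ?case .
  qed
qed measurable

lemma indep_vars_pair:
  fixes X :: "'i \<Rightarrow> 'a \<Rightarrow> 'b::euclidean_space"
  assumes "indep_vars (\<lambda>_. borel) X I" "j \<in> I" "k \<in> I" "j \<noteq> k"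
  shows "indep_var borel (X j) borel (X k)"
proof -
  have "indep_vars (\<lambda>_. borel) X (insert j {k})"
    using assms by (intro indep_vars_subset[OF assms(1)]) auto
  from indep_vars_sum_euclidean[OF _ _ this] show ?thesis using assms(4) by simp
qed

text \<open>Expand the product entrywise; by independence and centring the expectation of every cross term
  factors into zero.\<close>

lemma expectation_gram_sum:
  fixes S :: "'i \<Rightarrow> 'a \<Rightarrow> complex^'n^'m"
  assumes fin: "finite I" and ind: "indep_vars (\<lambda>_. borel) S I"
    and mean: "\<And>k. k \<in> I \<Longrightarrow> matrix_expectation M (S k) = 0"
    and bd: "\<And>k. k \<in> I \<Longrightarrow> AE \<omega> in M. spectral_norm (S k \<omega>) \<le> L"
  shows "matrix_expectation M (\<lambda>\<omega>. (\<Sum>k\<in>I. S k \<omega>) ** conj_transpose (\<Sum>k\<in>I. S k \<omega>))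
    = (\<Sum>k\<in>I. matrix_expectation M (\<lambda>\<omega>. S k \<omega> ** conj_transpose (S k \<omega>)))"
proof -
  have meas: "S k \<in> borel_measurable M" if "k \<in> I" for k
    using ind that by (simp add: indep_vars_def)
  have em: "(\<lambda>\<omega>. S k \<omega> $ a $ c) \<in> borel_measurable M" if "k \<in> I" for k a c
    by (rule measurable_compose[OF meas[OF that] entry_measurable])
  have "matrix_expectation M (\<lambda>\<omega>. (\<Sum>k\<in>I. S k \<omega>) ** conj_transpose (\<Sum>k\<in>I. S k \<omega>)) $ a $ b
     = (\<Sum>k\<in>I. matrix_expectation M (\<lambda>\<omega>. S k \<omega> ** conj_transpose (S k \<omega>)) $ a $ b)" for a b
  proof -
    define e where "e c j k \<omega> = S j \<omega> $ a $ c * cnj (S k \<omega> $ b $ c)" for c j k \<omega>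
    have int: "integrable M (e c j k)" if "j \<in> I" "k \<in> I" for c j k
    proof (rule integrable_const_bound[where B="L * L"])
      show "AE \<omega> in M. norm (e c j k \<omega>) \<le> L * L"
        using bd[OF that(1)] bd[OF that(2)]
      proof eventually_elim
        case (elim \<omega>)
        have "norm (S j \<omega> $ a $ c) \<le> L" "norm (S k \<omega> $ b $ c) \<le> L"
          using elim order_trans[OF entry_le_spectral_norm] by auto
        then have "norm (S j \<omega> $ a $ c) * norm (S k \<omega> $ b $ c) \<le> L * L"
          by (intro mult_mono) (auto intro: order_trans[OF norm_ge_zero])
        then show ?case by (simp add: e_def norm_mult)
      qed
      have [measurable]: "(\<lambda>\<omega>. S j \<omega> $ a $ c) \<in> borel_measurable M" "(\<lambda>\<omega>. S k \<omega> $ b $ c) \<in> borel_measurable M"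
        using em that by auto
      show "e c j k \<in> borel_measurable M" unfolding e_def[abs_def] 
        by (intro borel_measurable_times borel_measurable_continuous_on[of cnj]) (auto intro: continuous_intros)
    qed
    have zero: "expectation (e c j k) = 0" if "j \<in> I" "k \<in> I" "j \<noteq> k" for c j k
    proof -
      have "expectation (\<lambda>\<omega>. S j \<omega> $ a $ c) = matrix_expectation M (S j) $ a $ c"
        by (simp add: matrix_expectation_def)
      then have 0: "expectation (\<lambda>\<omega>. S j \<omega> $ a $ c) = 0" using mean[OF that(1)] by simp
      have "indep_var borel ((\<lambda>A. A $ a $ c) \<circ> S j) borel ((\<lambda>A. cnj (A $ b $ c)) \<circ> S k)"
        by (rule indep_var_compose[OF indep_vars_pair[OF ind that]])
          (intro borel_measurable_continuous_onI continuous_intros)+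
      then have iv: "indep_var borel (\<lambda>\<omega>. S j \<omega> $ a $ c) borel (\<lambda>\<omega>. cnj (S k \<omega> $ b $ c))"
        by (simp add: o_def)
      have sj: "integrable M (\<lambda>\<omega>. S j \<omega> $ a $ c)" if "j \<in> I" for j a c
        using integrable_bounded_linear[OF bounded_linear_compose[OF bounded_linear_vec_nth bounded_linear_vec_nth]
          integrable_spectral_norm_bounded[OF meas[OF that] bd[OF that]]] .
      have "expectation (e c j k) = expectation (\<lambda>\<omega>. S j \<omega> $ a $ c) * expectation (\<lambda>\<omega>. cnj (S k \<omega> $ b $ c))"
        unfolding e_def
        by (rule indep_var_lebesgue_integral[OF iv sj[OF that(1)] integrable_bounded_linear[OF bounded_linear_cnj sj[OF that(2)]]])
      then show ?thesis by (simp add: 0)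
    qed
    have "matrix_expectation M (\<lambda>\<omega>. (\<Sum>k\<in>I. S k \<omega>) ** conj_transpose (\<Sum>k\<in>I. S k \<omega>)) $ a $ b
        = expectation (\<lambda>\<omega>. \<Sum>c\<in>UNIV. \<Sum>j\<in>I. \<Sum>k\<in>I. e c j k \<omega>)"
      by (simp add: matrix_expectation_def matrix_matrix_mult_def conj_transpose_def e_def sum_product)
    also have "\<dots> = (\<Sum>c\<in>UNIV. \<Sum>j\<in>I. \<Sum>k\<in>I. expectation (e c j k))"
      using int by (simp add: Bochner_Integration.integral_sum integrable_sum)
    also have "\<dots> = (\<Sum>c\<in>UNIV. \<Sum>j\<in>I. \<Sum>k\<in>I. if k = j then expectation (e c j j) else 0)"
      by (intro sum.cong refl) (auto simp: zero)
    also have "\<dots> = (\<Sum>k\<in>I. \<Sum>c\<in>UNIV. expectation (e c k k))"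
      using fin by (subst sum.swap) (simp cong: sum.cong)
    also have "\<dots> = (\<Sum>k\<in>I. expectation (\<lambda>\<omega>. \<Sum>c\<in>UNIV. e c k k \<omega>))"
      using int by (intro sum.cong refl) (simp add: Bochner_Integration.integral_sum)
    finally show ?thesis
      by (simp add: matrix_expectation_def matrix_matrix_mult_def conj_transpose_def e_def)
  qed
  then show ?thesis by (simp add: vec_eq_iff)
qed

lemma expectation_le_of_nn_integral:
  fixes f :: "'a \<Rightarrow> real"
  assumes [measurable]: "f \<in> borel_measurable M" and pos: "\<And>\<omega>. f \<omega> \<ge> 0"
    and le: "(\<integral>\<^sup>+\<omega>. ennreal (f \<omega>) \<partial>M) \<le> ennreal c" and c: "c \<ge> 0"
  shows "integrable M f" "expectation f \<le> c"
proof -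
  show i: "integrable M f"
    using le pos by (intro integrableI_nonneg) (auto intro: le_less_trans)
  have "ennreal (expectation f) \<le> ennreal c"
    using nn_integral_eq_integral[OF i] pos le by simp
  then show "expectation f \<le> c" using c by (simp add: ennreal_le_iff)
qed

end

section \<open>The matrix Bernstein inequality\<close>

lemma inner_mult_le_spectral_norm: "y \<bullet> (A *v y) \<le> spectral_norm A * (y \<bullet> y)" for A :: "complex^'n^'n"
proof -
  have "y \<bullet> (A *v y) \<le> norm y * norm (A *v y)" by (rule norm_cauchy_schwarz)
  also have "\<dots> \<le> norm y * (spectral_norm A * norm y)" by (intro mult_left_mono spectral_norm_mult) simp
  finally show ?thesis by (simp add: dot_square_norm power2_eq_square mult_ac)
qed

context prob_space
begin

lemma integral_quadratic_complex:
  fixes X :: "'a \<Rightarrow> complex^'n^'n"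
  assumes "integrable M X"
  shows "integrable M (\<lambda>\<omega>. x \<bullet> (X \<omega> *v x))"
    and "expectation (\<lambda>\<omega>. x \<bullet> (X \<omega> *v x)) = x \<bullet> (matrix_expectation M X *v x)"
proof -
  have bl: "bounded_linear (\<lambda>A :: complex^'n^'n. x \<bullet> (A *v x))"
    using bounded_linear_compose[OF bounded_linear_inner_right
      linear_conv_bounded_linear[THEN iffD1, OF linear_complex_matrix_vector_left]] .
  show "integrable M (\<lambda>\<omega>. x \<bullet> (X \<omega> *v x))"
    by (rule integrable_bounded_linear[OF bl assms])
  show "expectation (\<lambda>\<omega>. x \<bullet> (X \<omega> *v x)) = x \<bullet> (matrix_expectation M X *v x)"
    unfolding matrix_expectation_eq_integral[OF assms]
    by (rule integral_bounded_linear[OF bl assms])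
qed

lemma expectation_dilation_square:
  fixes X :: "'a \<Rightarrow> complex^'d2^'d1"
  assumes X [measurable]: "X \<in> borel_measurable M" and bd: "AE \<omega> in M. spectral_norm (X \<omega>) \<le> L" and L: "L \<ge> 0"
  shows "dilation_coords (x, y) \<bullet> (expectation (\<lambda>\<omega>. dilation (X \<omega>) ** dilation (X \<omega>)) *v dilation_coords (x, y))
    = y \<bullet> (matrix_expectation M (\<lambda>\<omega>. conj_transpose (X \<omega>) ** X \<omega>) *v y)
      + x \<bullet> (matrix_expectation M (\<lambda>\<omega>. X \<omega> ** conj_transpose (X \<omega>)) *v x)"
proof -
  have D [measurable]: "(\<lambda>\<omega>. dilation (X \<omega>)) \<in> borel_measurable M" by measurable
  have iD: "integrable M (\<lambda>\<omega>. dilation (X \<omega>) ** dilation (X \<omega>))"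
  proof (rule integrable_opbound)
    show "(\<lambda>\<omega>. dilation (X \<omega>) ** dilation (X \<omega>)) \<in> borel_measurable M"
      by (rule matrix_square_measurable[OF D])
    show "AE \<omega> in M. opbound (L * L) (dilation (X \<omega>) ** dilation (X \<omega>))"
      using bd by eventually_elim (rule opbound_square[OF L opbound_mono[OF opbound_dilation]])
  qed (simp add: matrix_transpose_mul transpose_dilation)
  have i1: "integrable M (\<lambda>\<omega>. X \<omega> ** conj_transpose (X \<omega>))" by (rule integrable_gram[OF X bd])
  have i2: "integrable M (\<lambda>\<omega>. conj_transpose (X \<omega>) ** X \<omega>)"
    using integrable_gram[of "\<lambda>\<omega>. conj_transpose (X \<omega>)" L] bd by (simp add: spectral_norm_conj_transpose)
  let ?z = "dilation_coords (x, y)"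
  have "?z \<bullet> (expectation (\<lambda>\<omega>. dilation (X \<omega>) ** dilation (X \<omega>)) *v ?z)
      = expectation (\<lambda>\<omega>. ?z \<bullet> ((dilation (X \<omega>) ** dilation (X \<omega>)) *v ?z))"
    unfolding inner_matrix_vector by (rule integral_inner_left[OF iD, symmetric])
  also have "\<dots> = expectation (\<lambda>\<omega>. y \<bullet> ((conj_transpose (X \<omega>) ** X \<omega>) *v y)
      + x \<bullet> ((X \<omega> ** conj_transpose (X \<omega>)) *v x))"
    unfolding dilation_square_quadratic ..
  also have "\<dots> = expectation (\<lambda>\<omega>. y \<bullet> ((conj_transpose (X \<omega>) ** X \<omega>) *v y))
      + expectation (\<lambda>\<omega>. x \<bullet> ((X \<omega> ** conj_transpose (X \<omega>)) *v x))"
    by (rule Bochner_Integration.integral_add[OF integral_quadratic_complex(1)[OF i2] integral_quadratic_complex(1)[OF i1]])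
  finally show ?thesis
    unfolding integral_quadratic_complex(2)[OF i1] integral_quadratic_complex(2)[OF i2] .
qed

text \<open>The trace bound for the dilations of the summands, with the factor 2 cancelled on both sides.\<close>

theorem spectral_norm_mgf_le:
  fixes S :: "'i \<Rightarrow> 'a \<Rightarrow> complex^'d2^'d1"
  assumes fin: "finite I" and ind: "indep_vars (\<lambda>_. borel) S I"
    and mean: "\<And>k. k \<in> I \<Longrightarrow> matrix_expectation M (S k) = 0"
    and bd: "\<And>k. k \<in> I \<Longrightarrow> AE \<omega> in M. spectral_norm (S k \<omega>) \<le> L" and L: "L \<ge> 0"
    and v1: "spectral_norm (\<Sum>k\<in>I. matrix_expectation M (\<lambda>\<omega>. S k \<omega> ** conj_transpose (S k \<omega>))) \<le> v"
    and v2: "spectral_norm (\<Sum>k\<in>I. matrix_expectation M (\<lambda>\<omega>. conj_transpose (S k \<omega>) ** S k \<omega>)) \<le> v"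
    and \<theta>: "\<theta> \<ge> 0" "\<theta> * L < 3"
  defines "b \<equiv> (real CARD('d1) + real CARD('d2)) * exp (\<theta>\<^sup>2 / (2 * (1 - \<theta> * L / 3)) * v)"
  shows "integrable M (\<lambda>\<omega>. exp (\<theta> * spectral_norm (\<Sum>k\<in>I. S k \<omega>)))"
    and "expectation (\<lambda>\<omega>. exp (\<theta> * spectral_norm (\<Sum>k\<in>I. S k \<omega>))) \<le> b"
proof -
  have meas [measurable]: "S k \<in> borel_measurable M" if "k \<in> I" for k
    using ind that by (simp add: indep_vars_def)
  define X where "X k \<omega> = dilation (S k \<omega>)" for k \<omega>
  have X: "(\<Sum>k\<in>I. X k \<omega>) = dilation (\<Sum>k\<in>I. S k \<omega>)" for \<omega>
    by (simp add: X_def linear_sum[OF linear_dilation])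
  have "(\<integral>\<^sup>+\<omega>. ennreal (trace (mexp (\<theta> *\<^sub>R (\<Sum>k\<in>I. X k \<omega>)))) \<partial>M)
    \<le> ennreal (real CARD(bool \<times> ('d1 + 'd2)) * exp (\<theta>\<^sup>2 / (2 * (1 - \<theta> * L / 3)) * v))"
  proof (rule trace_mexp_sum_bernstein[OF fin _ _ _ L _ _ \<theta>])
    show "indep_vars (\<lambda>_. borel) X I"
      unfolding X_def by (rule indep_vars_compose2[OF ind]) measurable
    show "transpose (X k \<omega>) = X k \<omega>" for k \<omega> by (simp add: X_def transpose_dilation)
    show "AE \<omega> in M. opbound L (X k \<omega>)" if "k \<in> I" for k
      using bd[OF that] unfolding X_def by eventually_elim (rule opbound_mono[OF opbound_dilation])
    show "expectation (X k) = 0" if "k \<in> I" for k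
    proof -
      have i: "integrable M (S k)" by (rule integrable_spectral_norm_bounded[OF meas bd]) (use that in auto)
      have "expectation (X k) = dilation (expectation (S k))"
        unfolding X_def by (rule integral_bounded_linear[OF linear_conv_bounded_linear[THEN iffD1, OF linear_dilation] i])
      also have "\<dots> = 0"
        using mean[OF that] by (simp add: matrix_expectation_eq_integral[OF i] linear_0[OF linear_dilation])
      finally show ?thesis .
    qed
    show "(\<Sum>k\<in>I. z \<bullet> (expectation (\<lambda>\<omega>. X k \<omega> ** X k \<omega>) *v z)) \<le> v * (z \<bullet> z)" for z
    proof -
      obtain x y where z: "z = dilation_coords (x, y)" by (metis dilation_coords_surj surj_pair)
      have "(\<Sum>k\<in>I. z \<bullet> (expectation (\<lambda>\<omega>. X k \<omega> ** X k \<omega>) *v z))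
        = (\<Sum>k\<in>I. y \<bullet> (matrix_expectation M (\<lambda>\<omega>. conj_transpose (S k \<omega>) ** S k \<omega>) *v y)
          + x \<bullet> (matrix_expectation M (\<lambda>\<omega>. S k \<omega> ** conj_transpose (S k \<omega>)) *v x))"
        unfolding X_def z by (intro sum.cong refl expectation_dilation_square[OF meas bd L])
      also have "\<dots> = y \<bullet> ((\<Sum>k\<in>I. matrix_expectation M (\<lambda>\<omega>. conj_transpose (S k \<omega>) ** S k \<omega>)) *v y)
          + x \<bullet> ((\<Sum>k\<in>I. matrix_expectation M (\<lambda>\<omega>. S k \<omega> ** conj_transpose (S k \<omega>))) *v x)"
        by (simp add: sum.distrib linear_sum[OF linear_complex_matrix_vector_left] inner_sum_right)
      also have "\<dots> \<le> v * (y \<bullet> y) + v * (x \<bullet> x)"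
        by (intro add_mono order_trans[OF inner_mult_le_spectral_norm] mult_right_mono v1 v2) auto
      also have "\<dots> = v * (z \<bullet> z)"
        by (simp add: z dilation_coords_inner inner_prod_def algebra_simps)
      finally show ?thesis .
    qed
  qed
  moreover have card: "real CARD(bool \<times> ('d1 + 'd2)) = 2 * (real CARD('d1) + real CARD('d2))"
    by (simp add: card_UNIV_sum)
  ultimately have nn: "(\<integral>\<^sup>+\<omega>. ennreal (trace (mexp (\<theta> *\<^sub>R dilation (\<Sum>k\<in>I. S k \<omega>)))) \<partial>M) \<le> ennreal (2 * b)"
    by (simp only: X b_def card mult.assoc)
  have Z [measurable]: "(\<lambda>\<omega>. \<Sum>k\<in>I. S k \<omega>) \<in> borel_measurable M"
    by (intro borel_measurable_sum) (rule meas)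
  have le: "2 * exp (\<theta> * spectral_norm (\<Sum>k\<in>I. S k \<omega>)) \<le> trace (mexp (\<theta> *\<^sub>R dilation (\<Sum>k\<in>I. S k \<omega>)))" for \<omega>
    by (rule trace_mexp_dilation_ge[OF \<theta>(1)])
  have "(\<integral>\<^sup>+\<omega>. ennreal (2 * exp (\<theta> * spectral_norm (\<Sum>k\<in>I. S k \<omega>))) \<partial>M) \<le> ennreal (2 * b)"
    by (rule order_trans[OF nn_integral_mono nn]) (intro ennreal_leI le)
  from expectation_le_of_nn_integral[OF _ _ this]
  have "integrable M (\<lambda>\<omega>. 2 * exp (\<theta> * spectral_norm (\<Sum>k\<in>I. S k \<omega>)))"
    "expectation (\<lambda>\<omega>. 2 * exp (\<theta> * spectral_norm (\<Sum>k\<in>I. S k \<omega>))) \<le> 2 * b"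
    by (simp_all add: b_def)
  then show "integrable M (\<lambda>\<omega>. exp (\<theta> * spectral_norm (\<Sum>k\<in>I. S k \<omega>)))"
    and "expectation (\<lambda>\<omega>. exp (\<theta> * spectral_norm (\<Sum>k\<in>I. S k \<omega>))) \<le> b"
    by simp_all
qed

text \<open>The Chernoff bound with \<open>\<theta> = t / (v + L t / 3)\<close>. For \<open>v = 0\<close> this choice hits the excluded endpoint
  \<open>\<theta> L = 3\<close>, and half of it already suffices. If the denominator vanishes, the quotient is zero by
  convention and the bound is at least one.\<close>

lemma bernstein_tail:
  fixes Y :: "'a \<Rightarrow> real"
  assumes Y [measurable]: "Y \<in> borel_measurable M"
    and v: "v \<ge> 0" and L: "L \<ge> 0" and d: "d \<ge> 1"
    and int: "\<And>\<theta>. \<theta> \<ge> 0 \<Longrightarrow> \<theta> * L < 3 \<Longrightarrow> integrable M (\<lambda>\<omega>. exp (\<theta> * Y \<omega>))"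
    and mgf: "\<And>\<theta>. \<theta> \<ge> 0 \<Longrightarrow> \<theta> * L < 3 \<Longrightarrow>
      expectation (\<lambda>\<omega>. exp (\<theta> * Y \<omega>)) \<le> d * exp (\<theta>\<^sup>2 / (2 * (1 - \<theta> * L / 3)) * v)"
    and t: "t \<ge> 0"
  shows "prob {\<omega> \<in> space M. Y \<omega> \<ge> t} \<le> d * exp ((- (t\<^sup>2) / 2) / (v + L * t / 3))"
proof -
  have chernoff: "prob {\<omega> \<in> space M. Y \<omega> \<ge> t} \<le> d * exp (\<theta>\<^sup>2 / (2 * (1 - \<theta> * L / 3)) * v - \<theta> * t)"
    if \<theta>: "\<theta> \<ge> 0" "\<theta> * L < 3" for \<theta>
  proof -
    have "exp (\<theta> * t) * prob {\<omega> \<in> space M. Y \<omega> \<ge> t}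
        = expectation (\<lambda>\<omega>. exp (\<theta> * t) * indicator {\<omega> \<in> space M. Y \<omega> \<ge> t} \<omega>)"
      by simp
    also have "\<dots> \<le> expectation (\<lambda>\<omega>. exp (\<theta> * Y \<omega>))"
    proof (rule integral_mono[OF _ int[OF \<theta>]])
      show "integrable M (\<lambda>\<omega>. exp (\<theta> * t) * indicator {\<omega> \<in> space M. Y \<omega> \<ge> t} \<omega> :: real)"
        by (intro integrable_mult_right integrable_real_indicator) (auto simp: emeasure_eq_measure)
    qed (auto simp: indicator_def intro: mult_left_mono \<theta>)
    also have "\<dots> \<le> d * exp (\<theta>\<^sup>2 / (2 * (1 - \<theta> * L / 3)) * v)" by (rule mgf[OF \<theta>])
    finally show ?thesis by (simp add: exp_diff field_simps)
  qed
  consider "v > 0" | "v = 0" "L * t > 0" | "v + L * t / 3 = 0"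
    using v L t mult_nonneg_nonneg[OF L t] by linarith
  then show ?thesis
  proof cases
    case 1
    define D where "D = v + L * t / 3"
    have D: "D > 0" using 1 L t by (simp add: D_def add_pos_nonneg)
    have D1: "1 - t / D * L / 3 = v / D" using D by (simp add: D_def field_simps)
    have "t * L < 3 * D" using 1 by (simp add: D_def)
    then have "t / D * L < 3" using D by (simp add: field_simps)
    then have "prob {\<omega> \<in> space M. Y \<omega> \<ge> t} \<le> d * exp ((t / D)\<^sup>2 / (2 * (v / D)) * v - t / D * t)"
      using chernoff[of "t / D"] D t unfolding D1 by simp
    also have "(t / D)\<^sup>2 / (2 * (v / D)) * v - t / D * t = (- (t\<^sup>2) / 2) / D"
      using D 1 by (simp add: field_simps power2_eq_square)
    finally show ?thesis by (simp add: D_def)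
  next
    case 2
    then have pos: "L > 0" "t > 0" using L t by (auto simp: zero_less_mult_iff)
    have "prob {\<omega> \<in> space M. Y \<omega> \<ge> t} \<le> d * exp (- (3 / (2 * L) * t))"
      using chernoff[of "3 / (2 * L)"] pos 2 by simp
    also have "- (3 / (2 * L) * t) = (- (t\<^sup>2) / 2) / (v + L * t / 3)"
      using 2 pos by (simp add: field_simps power2_eq_square)
    finally show ?thesis .
  next
    case 3
    have "prob {\<omega> \<in> space M. Y \<omega> \<ge> t} \<le> 1" by (rule prob_le_1)
    also note d
    finally show ?thesis unfolding 3 by simp
  qed
qed

text \<open>Jensen's inequality for \<open>exp\<close> bounds the mean by \<open>ln d / \<theta> + \<theta> v / (2 (1 - \<theta> L / 3))\<close>. In the parameter
  \<open>s = 1 / \<theta> - L / 3\<close>, which ranges over all positive numbers, this is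
  \<open>ln d * (L / 3 + s) + v / (2 s)\<close>, minimized at \<open>s = sqrt (v / (2 ln d))\<close>; for \<open>v = 0\<close> let \<open>s\<close> tend to 0.\<close>

lemma bernstein_expectation:
  fixes Y :: "'a \<Rightarrow> real"
  assumes Y [measurable]: "Y \<in> borel_measurable M" and Y0: "\<And>\<omega>. Y \<omega> \<ge> 0"
    and v: "v \<ge> 0" and L: "L \<ge> 0" and d: "d > 1"
    and int: "\<And>\<theta>. \<theta> \<ge> 0 \<Longrightarrow> \<theta> * L < 3 \<Longrightarrow> integrable M (\<lambda>\<omega>. exp (\<theta> * Y \<omega>))"
    and mgf: "\<And>\<theta>. \<theta> \<ge> 0 \<Longrightarrow> \<theta> * L < 3 \<Longrightarrow>
      expectation (\<lambda>\<omega>. exp (\<theta> * Y \<omega>)) \<le> d * exp (\<theta>\<^sup>2 / (2 * (1 - \<theta> * L / 3)) * v)"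
  shows "expectation Y \<le> sqrt (2 * v * ln d) + 1 / 3 * L * ln d"
proof -
  define m where "m = expectation Y"
  define a where "a = ln d"
  have a: "a > 0" using d by (simp add: a_def)
  have key: "m \<le> a * (L / 3 + s) + v / (2 * s)" if s: "s > 0" for s
  proof -
    define \<theta> where "\<theta> = 1 / (L / 3 + s)"
    have Ls: "L / 3 + s > 0" using L s by (simp add: add_nonneg_pos)
    have \<theta>: "\<theta> > 0" "\<theta> * L < 3" using Ls s by (simp_all add: \<theta>_def field_simps)
    have i: "integrable M (\<lambda>\<omega>. exp (\<theta> * Y \<omega>))" using int \<theta> by simp
    have iY: "integrable M Y"
    proof (rule Bochner_Integration.integrable_bound[OF integrable_mult_right[OF i, of "1 / \<theta>"]])
      have "Y \<omega> \<le> 1 / \<theta> * exp (\<theta> * Y \<omega>)" for \<omega>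
      proof -
        have "\<theta> * Y \<omega> \<le> exp (\<theta> * Y \<omega>)" using exp_ge_add_one_self[of "\<theta> * Y \<omega>"] by linarith
        then show ?thesis using \<theta>(1) by (simp add: field_simps)
      qed
      then show "AE \<omega> in M. norm (Y \<omega>) \<le> norm (1 / \<theta> * exp (\<theta> * Y \<omega>))"
        using Y0 \<theta>(1) by (simp add: abs_of_nonneg)
    qed simp
    \<comment> \<open>Integrating the tangent line of \<open>exp\<close> at \<open>\<theta> m\<close> gives Jensen.\<close>
    have "exp (\<theta> * m) = expectation (\<lambda>\<omega>. exp (\<theta> * m) * (1 + \<theta> * (Y \<omega> - m)))"
      using iY by (simp add: prob_space m_def)
    also have "\<dots> \<le> expectation (\<lambda>\<omega>. exp (\<theta> * Y \<omega>))"
    proof (rule integral_mono[OF _ i])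
      fix \<omega>
      have "exp (\<theta> * m) * (1 + \<theta> * (Y \<omega> - m)) \<le> exp (\<theta> * m) * exp (\<theta> * (Y \<omega> - m))"
        by (intro mult_left_mono exp_ge_add_one_self) simp
      then show "exp (\<theta> * m) * (1 + \<theta> * (Y \<omega> - m)) \<le> exp (\<theta> * Y \<omega>)"
        by (simp add: exp_add[symmetric] algebra_simps)
    qed (use iY in simp)
    also have "\<dots> \<le> d * exp (\<theta>\<^sup>2 / (2 * (1 - \<theta> * L / 3)) * v)" using mgf \<theta> by simp
    also have "\<dots> = exp (a + \<theta>\<^sup>2 / (2 * (1 - \<theta> * L / 3)) * v)" using d by (simp add: a_def exp_add)
    finally have "\<theta> * m \<le> a + \<theta>\<^sup>2 / (2 * (1 - \<theta> * L / 3)) * v" by simp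
    also have "1 - \<theta> * L / 3 = s * \<theta>" using Ls by (simp add: \<theta>_def field_simps)
    also have "a + \<theta>\<^sup>2 / (2 * (s * \<theta>)) * v = \<theta> * (a / \<theta> + v / (2 * s))"
      using \<theta>(1) s by (simp add: field_simps power2_eq_square)
    finally have "m \<le> a / \<theta> + v / (2 * s)" using \<theta>(1) by (simp only: mult_le_cancel_left_pos)
    then show ?thesis by (simp add: \<theta>_def)
  qed
  have "m \<le> sqrt (2 * v * a) + 1 / 3 * L * a"
  proof (cases "v = 0")
    case True
    have "m \<le> 1 / 3 * L * a + e" if "e > 0" for e
    proof -
      have "a * (L / 3 + e / a) = 1 / 3 * L * a + e" using a by (simp add: field_simps)
      then show ?thesis using key[of "e / a"] that a by (simp add: True)
    qed
    then have "m \<le> 1 / 3 * L * a" by (rule field_le_epsilon)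
    then show ?thesis by (simp add: True)
  next
    case False
    define r where "r = sqrt (2 * v * a)"
    have r: "r > 0" "r * r = 2 * v * a" using False v a by (simp_all add: r_def)
    have "m \<le> a * (L / 3 + r / (2 * a)) + v / (2 * (r / (2 * a)))" by (rule key) (use r a in simp)
    also have "v / (2 * (r / (2 * a))) = r / 2"
      using r a by (simp add: field_simps)
    also have "a * (L / 3 + r / (2 * a)) + r / 2 = r + 1 / 3 * L * a" using a by (simp add: field_simps)
    finally show ?thesis by (simp add: r_def)
  qed
  then show ?thesis by (simp add: m_def a_def)
qed

end

theorem theorem1p6p2:
  fixes M :: "'a measure"
    and S :: "nat \<Rightarrow> 'a \<Rightarrow> complex^'d2^'d1"
    and n :: nat
    and L :: real
  defines "Z \<equiv> \<lambda>\<omega>. \<Sum>k=1..n. S k \<omega>"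
  assumes "prob_space M"
    and "n \<ge> 1"
    and "prob_space.indep_vars M (\<lambda>_. borel) S {1..n}"
    and "\<forall>k\<in>{1..n}. matrix_expectation M (S k) = 0"
    and "\<forall>k\<in>{1..n}. AE \<omega> in M. spectral_norm (S k \<omega>) \<le> L"
  shows "matrix_variance M Z =
           max (spectral_norm (\<Sum>k=1..n.
                  matrix_expectation M (\<lambda>\<omega>. S k \<omega> ** conj_transpose (S k \<omega>))))
               (spectral_norm (\<Sum>k=1..n.
                  matrix_expectation M (\<lambda>\<omega>. conj_transpose (S k \<omega>) ** S k \<omega>)))
       \<and> (\<forall>t\<ge>0. measure M {\<omega> \<in> space M. spectral_norm (Z \<omega>) \<ge> t}
            \<le> (real CARD('d1) + real CARD('d2)) *
               exp ((- (t\<^sup>2) / 2) / (matrix_variance M Z + L * t / 3)))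
       \<and> integral\<^sup>L M (\<lambda>\<omega>. spectral_norm (Z \<omega>))
            \<le> sqrt (2 * matrix_variance M Z * ln (real CARD('d1) + real CARD('d2)))
               + 1 / 3 * L * ln (real CARD('d1) + real CARD('d2))"
proof -
  interpret prob_space M by fact
  define I where "I = {1..n}"
  have ind: "indep_vars (\<lambda>_. borel) S I" and mean: "\<And>k. k \<in> I \<Longrightarrow> matrix_expectation M (S k) = 0"
    and bd: "\<And>k. k \<in> I \<Longrightarrow> AE \<omega> in M. spectral_norm (S k \<omega>) \<le> L" and fin: "finite I"
    using assms by (auto simp: I_def)
  have Z: "Z = (\<lambda>\<omega>. \<Sum>k\<in>I. S k \<omega>)" by (simp add: Z_def I_def)
  have meas: "S k \<in> borel_measurable M" if "k \<in> I" for k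
    using ind that by (simp add: indep_vars_def)
  have [measurable]: "Z \<in> borel_measurable M"
    unfolding Z by (intro borel_measurable_sum meas)
  have L: "L \<ge> 0"
  proof -
    have "AE \<omega> in M. spectral_norm (S 1 \<omega>) \<le> L" by (rule bd) (use \<open>n \<ge> 1\<close> in \<open>simp add: I_def\<close>)
    then have "AE \<omega> in M. 0 \<le> L"
      by eventually_elim (rule order_trans[OF spectral_norm_nonneg])
    then show ?thesis by simp
  qed
  define v where "v = max (spectral_norm (\<Sum>k\<in>I. matrix_expectation M (\<lambda>\<omega>. S k \<omega> ** conj_transpose (S k \<omega>))))
               (spectral_norm (\<Sum>k\<in>I. matrix_expectation M (\<lambda>\<omega>. conj_transpose (S k \<omega>) ** S k \<omega>)))"
  have v0: "v \<ge> 0" by (simp add: v_def spectral_norm_nonneg le_max_iff_disj)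
  have v12: "spectral_norm (\<Sum>k\<in>I. matrix_expectation M (\<lambda>\<omega>. S k \<omega> ** conj_transpose (S k \<omega>))) \<le> v"
      "spectral_norm (\<Sum>k\<in>I. matrix_expectation M (\<lambda>\<omega>. conj_transpose (S k \<omega>) ** S k \<omega>)) \<le> v"
    by (simp_all add: v_def)
  have var: "matrix_variance M Z = v"
  proof -
    have 1: "matrix_expectation M (\<lambda>\<omega>. Z \<omega> ** conj_transpose (Z \<omega>))
        = (\<Sum>k\<in>I. matrix_expectation M (\<lambda>\<omega>. S k \<omega> ** conj_transpose (S k \<omega>)))"
      unfolding Z by (rule expectation_gram_sum[OF fin ind mean bd])
    \<comment> \<open>The second Gram matrix is the first one for the conjugate transposes.\<close>
    have "matrix_expectation M (\<lambda>\<omega>. (\<Sum>k\<in>I. conj_transpose (S k \<omega>)) ** conj_transpose (\<Sum>k\<in>I. conj_transpose (S k \<omega>)))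
        = (\<Sum>k\<in>I. matrix_expectation M (\<lambda>\<omega>. conj_transpose (S k \<omega>) ** conj_transpose (conj_transpose (S k \<omega>))))"
    proof (rule expectation_gram_sum[OF fin, where L=L])
      show "indep_vars (\<lambda>_. borel) (\<lambda>k \<omega>. conj_transpose (S k \<omega>)) I"
        by (rule indep_vars_compose2[OF ind]) measurable
      show "matrix_expectation M (\<lambda>\<omega>. conj_transpose (S k \<omega>)) = 0" if "k \<in> I" for k
        using mean[OF that] by (simp add: matrix_expectation_def conj_transpose_def vec_eq_iff)
      show "AE \<omega> in M. spectral_norm (conj_transpose (S k \<omega>)) \<le> L" if "k \<in> I" for k
        using bd[OF that] by (simp add: spectral_norm_conj_transpose)
    qed
    then have 2: "matrix_expectation M (\<lambda>\<omega>. conj_transpose (Z \<omega>) ** Z \<omega>)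
        = (\<Sum>k\<in>I. matrix_expectation M (\<lambda>\<omega>. conj_transpose (S k \<omega>) ** S k \<omega>))"
      by (simp add: Z conj_transpose_sum[symmetric])
    show ?thesis by (simp add: matrix_variance_def 1 2 v_def)
  qed
  define d where "d = real CARD('d1) + real CARD('d2)"
  have d: "d \<ge> 2"
  proof -
    have "real CARD('d1) \<ge> 1" "real CARD('d2) \<ge> 1" by (simp_all add: Suc_leI)
    then show ?thesis unfolding d_def by linarith
  qed
  have mgf: "integrable M (\<lambda>\<omega>. exp (\<theta> * spectral_norm (Z \<omega>)))"
      "expectation (\<lambda>\<omega>. exp (\<theta> * spectral_norm (Z \<omega>))) \<le> d * exp (\<theta>\<^sup>2 / (2 * (1 - \<theta> * L / 3)) * v)"
    if "\<theta> \<ge> 0" "\<theta> * L < 3" for \<theta>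
    unfolding Z d_def
    by - (rule spectral_norm_mgf_le[OF fin ind mean bd L v12 that]; assumption)+
  have "prob {\<omega> \<in> space M. spectral_norm (Z \<omega>) \<ge> t} \<le> d * exp ((- (t\<^sup>2) / 2) / (v + L * t / 3))"
    if "t \<ge> 0" for t
    by (rule bernstein_tail[OF _ v0 L _ mgf that]) (use d in auto)
  moreover have "expectation (\<lambda>\<omega>. spectral_norm (Z \<omega>)) \<le> sqrt (2 * v * ln d) + 1 / 3 * L * ln d"
    by (rule bernstein_expectation[OF _ spectral_norm_nonneg v0 L _ mgf]) (use d in auto)
  ultimately show ?thesis
    unfolding var d_def[symmetric] by (simp add: v_def[unfolded I_def])
qed

end
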